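(* There is a bounded function $e_9$ on the positive integers such that $M(9, n) = \lfloor n/17\rfloor + e_9(n)$ for all positive integers $n$; equivalently, $M(9,n)-\lfloor n/17\rfloor$ is bounded as $n$ ranges over the positive integers.
   Context: The $T$-tetromino is the polyomino formed by four unit squares: three in a row together with a fourth square attached to the middle square of that row. A tiling of an $m\times n$ rectangle (of unit cells) by $T$-tetrominos and monominos is a partition of its cells into copies of the $T$-tetromino (in any rotation or reflection, aligned with the grid) and single cells (monominos). The gap number $M(m,n)$ is the least number of monominos occurring in such a tiling of the $m\times n$ rectangle. *)

theory Defs
  imports Complex_Main "HOL-Library.Disjoint_Sets"
begin

text \<open>A unit cell of the square grid is represented by its integer coordinates.\<close>

type_synonym cell = "int \<times> int"

definition rectangle :: "nat \<Rightarrow> nat \<Rightarrow> cell set" where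
  "rectangle m n = {0..<int m} \<times> {0..<int n}"

text \<open>The symmetries of the grid: a translation composed with one of the eight rotations and
  reflections fixing the origin.\<close>

definition grid_isometries :: "(cell \<Rightarrow> cell) set" where
  "grid_isometries =
     {f. \<exists>a b s t. s \<in> {1, -1} \<and> t \<in> {1, -1} \<and>
        (f = (\<lambda>(x, y). (a + s * x, b + t * y)) \<or> f = (\<lambda>(x, y). (a + s * y, b + t * x)))}"

definition T_tetromino :: "cell set" where
  "T_tetromino = {(0, 0), (1, 0), (2, 0), (1, 1)}"

definition is_T_tetromino :: "cell set \<Rightarrow> bool" where
  "is_T_tetromino t \<longleftrightarrow> (\<exists>f \<in> grid_isometries. t = f ` T_tetromino)"

definition is_monomino :: "cell set \<Rightarrow> bool" where
  "is_monomino t \<longleftrightarrow> (\<exists>c. t = {c})"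

definition is_tiling :: "nat \<Rightarrow> nat \<Rightarrow> cell set set \<Rightarrow> bool" where
  "is_tiling m n P \<longleftrightarrow>
     partition_on (rectangle m n) P \<and> (\<forall>t \<in> P. is_T_tetromino t \<or> is_monomino t)"

definition num_monominos :: "cell set set \<Rightarrow> nat" where
  "num_monominos P = card {t \<in> P. is_monomino t}"

definition gap_number :: "nat \<Rightarrow> nat \<Rightarrow> nat" where
  "gap_number m n = (LEAST k. \<exists>P. is_tiling m n P \<and> num_monominos P = k)"

text \<open>A tiling always exists and has finitely many tiles, so the minimum and the cardinality
  above are genuine.\<close>

lemma is_tiling_singletons: "is_tiling m n ((\<lambda>c. {c}) ` rectangle m n)"
  by (auto simp: is_tiling_def is_monomino_def partition_on_def disjoint_def)

lemma is_tiling_finite: "is_tiling m n P \<Longrightarrow> finite P"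
  by (rule finite_elements[of "rectangle m n"]) (auto simp: is_tiling_def rectangle_def)

lemma gap_number_attained: "\<exists>P. is_tiling m n P \<and> num_monominos P = gap_number m n"
  unfolding gap_number_def
  by (rule LeastI_ex) (use is_tiling_singletons in blast)

end

theory Submission
  imports Defs
begin

text \<open>For the upper bound, the infinite strip of width 9 has a tiling of period 17 with one monomino
  per period; cutting it to \<open>n\<close> columns costs a bounded number of further monominos.

  For the lower bound, place the tiles of a tiling in the column-by-column order of their first
  cells. The state before a column records which cells of that column and the next are already
  covered; only 3880 states can be reached. Charge 17 for every monomino and pay back 1 for every
  column. Assign to each reachable state the least charge of reaching it,
  made nonnegative by a shift (a finite table); this value grows by at most the charge
  along every column step and is nonnegative, so the total charge \<open>17 M - n\<close> is bounded below.\<close>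

text \<open>Finite least charges exist only if no reachable cycle of states has negative total
  charge. The periodic tiling is a cycle of charge 0, since 17 columns pay for its single monomino;
  so 17 is the weight at which the two bounds meet. The values come from a shortest-path
  computation, but they enter the proof as a certificate: the empty state is listed, and every
  completion of a column from a listed state ends in a listed state and respects the inequality.
  This closure also shows that a tiling never leaves the listed states. The obstacle is the size of
  that check, which is carried out by rewriting with the simplifier. It explains the states as
  literal lists of 18 bits, the trie, its division into named parts, and the rewrite rules that keep
  a branch unevaluated until its condition is decided.\<close>

section \<open>Orientations of the T-tetromino\<close>

fun T_cells :: "bool \<times> int \<times> int \<times> int \<Rightarrow> cell list" where
  "T_cells (h, x, y, s) =
     (if h then [(x, y), (x, y + 1), (x, y + 2), (x + s, y + 1)]
      else [(x, y), (x + 1, y), (x + 2, y), (x + 1, y + s)])"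

lemma is_T_tetromino_T_cells:
  assumes "s \<in> {1, -1}"
  shows "is_T_tetromino (set (T_cells (h, x, y, s)))"
proof (cases h)
  case True
  have "(\<lambda>(x', y'). (x + s * y', y + 1 * x')) \<in> grid_isometries"
    using assms unfolding grid_isometries_def by blast
  moreover have "set (T_cells (h, x, y, s)) = (\<lambda>(x', y'). (x + s * y', y + 1 * x')) ` T_tetromino"
    using True by (auto simp: T_tetromino_def)
  ultimately show ?thesis unfolding is_T_tetromino_def by blast
next
  case False
  have "(\<lambda>(x', y'). (x + 1 * x', y + s * y')) \<in> grid_isometries"
    using assms unfolding grid_isometries_def by blast
  moreover have "set (T_cells (h, x, y, s)) = (\<lambda>(x', y'). (x + 1 * x', y + s * y')) ` T_tetromino"
    using False by (auto simp: T_tetromino_def)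
  ultimately show ?thesis unfolding is_T_tetromino_def by blast
qed

text \<open>A T-tetromino is symmetric about its stem, so the eight grid isometries yield only four
  orientations. In \<open>T_cells\<close>, \<open>h\<close> says that the bar runs along the strip,
  that is, in the second coordinate; \<open>(x, y)\<close> is the end of the bar with the smaller
  coordinate and \<open>s\<close> the side of the stem.\<close>

lemma T_tetromino_cases:
  assumes "is_T_tetromino t"
  obtains h x y s where "s \<in> {1, -1}" "t = set (T_cells (h, x, y, s))"
proof -
  obtain a b s u where su: "s \<in> {1, -1}" "u \<in> {1, -1}"
    and t: "t = (\<lambda>(x, y). (a + s * x, b + u * y)) ` T_tetromino \<or>
            t = (\<lambda>(x, y). (a + s * y, b + u * x)) ` T_tetromino"
    using assms unfolding is_T_tetromino_def grid_isometries_def by blast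
  from t show ?thesis
  proof
    assume "t = (\<lambda>(x, y). (a + s * x, b + u * y)) ` T_tetromino"
    \<comment> \<open>For \<open>s = -1\<close> the bar runs backwards from \<open>a\<close>, so its
      smaller end is \<open>a - 2\<close>; the stem stays on the side given by
      \<open>u\<close>.\<close>
    then have "t = set (T_cells (False, if s = 1 then a else a - 2, b, u))"
      using su by (auto simp: T_tetromino_def)
    with su show ?thesis using that by blast
  next
    assume "t = (\<lambda>(x, y). (a + s * y, b + u * x)) ` T_tetromino"
    then have "t = set (T_cells (True, a, if u = 1 then b else b - 2, s))"
      using su by (auto simp: T_tetromino_def)
    with su show ?thesis using that by blast
  qed
qed

lemma card_T_tetromino:
  assumes "is_T_tetromino t"
  shows "card t = 4"
proof -
  obtain h x y s where "s \<in> {1, -1}" "t = set (T_cells (h, x, y, s))"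
    using assms by (rule T_tetromino_cases)
  moreover from this(1) have "card (set (T_cells (h, x, y, s))) = 4"
    by (auto simp: card_insert_if)
  ultimately show ?thesis by simp
qed

section \<open>From packings to the gap number\<close>

text \<open>Filling the uncovered cells with monominos turns a packing into a tiling. The additive
  form avoids truncated subtraction.\<close>

lemma gap_number_le_packing:
  assumes disj: "disjoint Q" and sub: "\<Union>Q \<subseteq> rectangle m n"
    and T: "\<And>t. t \<in> Q \<Longrightarrow> is_T_tetromino t"
  shows "gap_number m n + 4 * card Q \<le> m * n"
proof -
  let ?R = "rectangle m n - \<Union>Q"
  let ?S = "(\<lambda>c. {c}) ` ?R"
  have card4: "card t = 4" if "t \<in> Q" for t
    using T[OF that] by (rule card_T_tetromino)
  have ne: "{} \<notin> Q" using card4 by fastforce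
  have not_mono: "\<not> is_monomino t" if "t \<in> Q" for t
    using card4[OF that] by (auto simp: is_monomino_def)
  have "partition_on (rectangle m n) (Q \<union> ?S)"
  proof (rule partition_onI)
    show "\<Union>(Q \<union> ?S) = rectangle m n" using sub by auto
    show "{} \<notin> Q \<union> ?S" using ne by auto
    show "disjnt p q" if "p \<in> Q \<union> ?S" "q \<in> Q \<union> ?S" "p \<noteq> q" for p q
      using that disj unfolding disjnt_def disjoint_def by blast
  qed
  then have tiling: "is_tiling m n (Q \<union> ?S)"
    using T by (auto simp: is_tiling_def is_monomino_def)
  have "{t \<in> Q \<union> ?S. is_monomino t} = ?S"
    using not_mono by (auto simp: is_monomino_def)
  then have "num_monominos (Q \<union> ?S) = card ?R"
    by (simp add: num_monominos_def card_image)
  with tiling have "gap_number m n \<le> card ?R"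
    unfolding gap_number_def by (metis (mono_tags, lifting) Least_le)
  also have "card ?R = m * n - card (\<Union>Q)"
    using sub by (subst card_Diff_subset) (auto simp: rectangle_def intro: finite_subset)
  also have union: "card (\<Union>Q) = 4 * card Q"
  proof -
    have "finite t" if "t \<in> Q" for t
      by (rule card_ge_0_finite) (simp add: card4[OF that])
    then have "card (\<Union>Q) = sum card Q" using disj by (rule card_Union_disjoint[rotated])
    then show ?thesis using card4 by simp
  qed
  finally have "gap_number m n \<le> m * n - 4 * card Q" .
  moreover have "4 * card Q \<le> m * n"
    using card_mono[OF _ sub] union by (simp add: rectangle_def)
  ultimately show ?thesis by linarith
qed


section \<open>A periodic packing\<close>

text \<open>The repeating part of a tiling of the infinite strip of width 9 with period 17; its 38 tiles
  leave free only the translates of the cell \<open>(4, 0)\<close>.\<close>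

definition pattern :: "(bool \<times> int \<times> int \<times> int) list" where
  "pattern =
    [(True, 1, 0, -1), (False, 2, 1, -1), (True, 6, 0, -1), (True, 8, 0, -1),
     (True, 0, 2, 1), (False, 2, 2, 1), (True, 5, 2, -1), (False, 6, 3, -1),
     (False, 1, 4, -1), (True, 4, 4, 1), (False, 6, 4, 1), (True, 0, 5, 1),
     (False, 1, 5, 1), (True, 6, 5, -1), (True, 8, 5, -1), (False, 2, 7, -1),
     (False, 0, 8, -1), (True, 5, 7, -1), (False, 6, 8, -1), (True, 3, 8, 1),
     (False, 0, 9, 1), (False, 6, 9, 1), (True, 0, 10, 1), (True, 2, 10, 1),
     (False, 4, 10, 1), (True, 8, 10, -1), (True, 4, 11, -1), (False, 5, 12, -1),
     (False, 0, 13, -1), (True, 3, 13, 1), (False, 5, 13, 1), (True, 8, 13, -1),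
     (False, 0, 14, 1), (False, 4, 15, -1), (True, 0, 15, 1), (True, 2, 15, 1),
     (True, 7, 15, 1), (False, 4, 16, 1)]"

text \<open>The bound 19 is 17 + 2: tiles may overhang the period by two columns.\<close>

lemma pattern_bounds:
  "\<forall>p \<in> set pattern. set (T_cells p) \<subseteq> {0..<9} \<times> {0..<19} \<and> snd (snd (snd p)) \<in> {1, -1}"
  by (simp add: pattern_def)

text \<open>Each cell is paired with its tile, so that injectivity on this list recovers the tile as
  well as the cell.\<close>

definition pattern_cells where
  "pattern_cells = concat (map (\<lambda>p. map (Pair p) (T_cells p)) pattern)"

text \<open>The number \<open>17 * x + y mod 17\<close> identifies a cell up to shifts by multiples
  of 17 columns. Distinctness of all 4 * 38 numbers says at once that the tiles are disjoint and
  that all their shifts are.\<close>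

lemma distinct_residues: "distinct (map (\<lambda>(p, x, y). 17 * x + y mod 17) pattern_cells)"
  by (simp add: pattern_cells_def pattern_def)

lemma distinct_pattern: "distinct pattern"
  by (simp add: pattern_def)


fun shift_T :: "nat \<Rightarrow> bool \<times> int \<times> int \<times> int \<Rightarrow> bool \<times> int \<times> int \<times> int" where
  "shift_T j (h, x, y, s) = (h, x, y + 17 * int j, s)"

lemma mem_T_cells_shift_T:
  "(x, y) \<in> set (T_cells (shift_T j p)) \<longleftrightarrow> (x, y - 17 * int j) \<in> set (T_cells p)"
  by (cases p) (simp add: algebra_simps)

lemma mem_pattern_cells:
  assumes "p \<in> set pattern" "c \<in> set (T_cells p)"
  shows "(p, c) \<in> set pattern_cells"
  unfolding pattern_cells_def set_concat set_map
  by (rule UN_I[OF imageI[OF assms(1)]]) (simp add: assms(2))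

text \<open>Undoing the two shifts of a common cell gives two entries of
  \<open>pattern_cells\<close> with the same residue, hence the same entry. Equality of the tiles is
  \<open>p = q\<close>; equality of the unshifted cells is \<open>i = j\<close>.\<close>

lemma shifted_tiles_meet:
  assumes "p \<in> set pattern" "q \<in> set pattern"
    and "c \<in> set (T_cells (shift_T i p))" "c \<in> set (T_cells (shift_T j q))"
  shows "p = q \<and> i = j"
proof -
  obtain x y where c: "c = (x, y)" by (cases c)
  have mem: "(p, x, y - 17 * int i) \<in> set pattern_cells"
    "(q, x, y - 17 * int j) \<in> set pattern_cells"
    using assms unfolding c mem_T_cells_shift_T by (auto intro: mem_pattern_cells)
  define r :: "_ \<Rightarrow> int" where "r = (\<lambda>(p :: bool \<times> int \<times> int \<times> int, x, y). 17 * x + y mod 17)"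
  have inj: "inj_on r (set pattern_cells)"
    using distinct_residues unfolding r_def distinct_map by (rule conjunct2)
  \<comment> \<open>The difference is written as an explicit multiple of 17, the form that
    \<open>mod_mult_self2\<close> removes.\<close>
  have "(y - 17 * int i) mod 17 = (y - 17 * int j + 17 * (int j - int i)) mod 17"
    by (simp add: algebra_simps)
  then have "(y - 17 * int i) mod 17 = (y - 17 * int j) mod 17"
    by (simp only: mod_mult_self2)
  then have "r (p, x, y - 17 * int i) = r (q, x, y - 17 * int j)"
    by (simp only: r_def prod.case)
  then have "(p, x, y - 17 * int i) = (q, x, y - 17 * int j)"
    by (rule inj_onD[OF inj _ mem])
  then show ?thesis by simp
qed

text \<open>One copy of the pattern covers 4 * 38 = 152 = 9 * 17 - 1 cells. With \<open>J\<close>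
  copies and at most \<open>17 * J + 18\<close> columns, at most
  \<open>153 * J + 162 - 152 * J = J + 162\<close> cells stay free.\<close>

lemma gap_number_9_le: "gap_number 9 n \<le> n div 17 + 162"
proof -
  \<comment> \<open>The two columns of overhang must still lie in the rectangle, hence
    \<open>n - 2\<close>; short rectangles get no copy at all.\<close>
  define J where "J = (n - 2) div 17"
  define I where "I = {..<J} \<times> set pattern"
  define tile where "tile = (\<lambda>(j, p). set (T_cells (shift_T j p)))"
  have J: "17 * J \<le> n - 2" "n < 17 * J + 19"
    unfolding J_def by linarith+
  have meet: "a = b" if "a \<in> I" "b \<in> I" "c \<in> tile a" "c \<in> tile b" for a b c
    using that shifted_tiles_meet[of "snd a" "snd b" c "fst a" "fst b"]
    by (simp add: I_def tile_def mem_Times_iff case_prod_beta prod_eq_iff)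
  \<comment> \<open>Equal tiles then share a cell, so that \<open>meet\<close> also gives
    injectivity, which is needed to count the tiles.\<close>
  have nonempty: "tile a \<noteq> {}" for a
  proof -
    obtain j h x y s where "a = (j, h, x, y, s)" by (cases a)
    then show ?thesis by (simp add: tile_def)
  qed
  have inj: "inj_on tile I"
  proof (rule inj_onI)
    fix a b assume ab: "a \<in> I" "b \<in> I" "tile a = tile b"
    obtain c where "c \<in> tile a" using nonempty by blast
    with ab show "a = b" by (intro meet[of a b c]) simp_all
  qed
  have "gap_number 9 n + 4 * card (tile ` I) \<le> 9 * n"
  proof (rule gap_number_le_packing)
    show "disjoint (tile ` I)"
      using meet unfolding pairwise_def disjnt_def by blast
    show "\<Union>(tile ` I) \<subseteq> rectangle 9 n"
    proof
      fix c assume "c \<in> \<Union>(tile ` I)"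
      then obtain j p where jp: "j < J" "p \<in> set pattern" and c: "c \<in> set (T_cells (shift_T j p))"
        by (auto simp: tile_def I_def)
      obtain x y where xy: "c = (x, y)" by (cases c)
      with c have "(x, y - 17 * int j) \<in> set (T_cells p)" by (simp only: mem_T_cells_shift_T)
      then have "(x, y - 17 * int j) \<in> {0..<9} \<times> {0..<19}" using pattern_bounds jp(2) by blast
      moreover have "17 * j + 19 \<le> n" using jp(1) J by linarith
      ultimately show "c \<in> rectangle 9 n" using xy by (simp add: rectangle_def)
    qed
    show "is_T_tetromino t" if "t \<in> tile ` I" for t
    proof -
      from that obtain j p where p: "p \<in> set pattern" and t: "t = set (T_cells (shift_T j p))"
        by (auto simp: tile_def I_def)
      obtain h x y s where hxys: "p = (h, x, y, s)" by (cases p)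
      with p pattern_bounds have "s \<in> {1, -1}" by fastforce
      then show ?thesis unfolding t hxys shift_T.simps by (rule is_T_tetromino_T_cells)
    qed
  qed
  moreover have "card (tile ` I) = J * 38"
  proof -
    have "card (set pattern) = 38"
      using distinct_pattern by (subst distinct_card) (simp_all add: pattern_def)
    then show ?thesis unfolding card_image[OF inj] by (simp add: I_def)
  qed
  moreover have "J \<le> n div 17" unfolding J_def by (simp add: div_le_mono)
  ultimately show ?thesis using J by linarith
qed


section \<open>Potentials on frontier states\<close>

text \<open>The state of a partial tiling before column \<open>y\<close> lists the covered cells of columns \<open>y\<close> and
  \<open>y + 1\<close> by 18 bits. A trie stores a partial function on the reversed bit lists: \<open>F\<close> and \<open>T\<close> are
  nodes with a single child, for the next bit being false or true.\<close>

datatype trie = V nat | F trie | T trie | B trie trie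

text \<open>The result \<open>None\<close> declares a state unreachable. This is a claim to be
  checked: \<open>column_ok\<close> fails on every run that ends in such a state.\<close>

fun lookup :: "trie \<Rightarrow> bool list \<Rightarrow> nat option" where
  "lookup (V v) [] = Some v"
| "lookup (F t) (b # s) = (if b then None else lookup t s)"
| "lookup (T t) (b # s) = (if b then lookup t s else None)"
| "lookup (B t u) (b # s) = (if b then lookup u s else lookup t s)"
| "lookup _ _ = None"

text \<open>Cells are ordered column by column. Each orientation of the T-tetromino is given by the
  offsets of its cells from the first one in this order, and entry \<open>x\<close> of \<open>rows\<close> lists the
  orientations whose first cell may lie in row \<open>x\<close>.\<close>

definition tshape1 :: "nat set" where "tshape1 = {0, 9, 10, 18}"
definition tshape2 :: "nat set" where "tshape2 = {0, 8, 9, 18}"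
definition tshape3 :: "nat set" where "tshape3 = {0, 1, 2, 10}"
definition tshape4 :: "nat set" where "tshape4 = {0, 8, 9, 10}"

lemmas tshape_defs = tshape1_def tshape2_def tshape3_def tshape4_def

definition rows :: "nat set list list" where
  "rows =
    [[tshape1, tshape3],
     [tshape1, tshape2, tshape3, tshape4],
     [tshape1, tshape2, tshape3, tshape4],
     [tshape1, tshape2, tshape3, tshape4],
     [tshape1, tshape2, tshape3, tshape4],
     [tshape1, tshape2, tshape3, tshape4],
     [tshape1, tshape2, tshape3, tshape4],
     [tshape1, tshape2, tshape4],
     [tshape2]]"

text \<open>Offset 18 lies just behind the 18-bit window. The cell there is always free, by
  \<open>occ_bound\<close> below, so only smaller offsets are tested.\<close>

definition fits :: "nat set \<Rightarrow> bool list \<Rightarrow> bool" where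
  "fits D s \<longleftrightarrow> (\<forall>i\<in>D. i < 18 \<longrightarrow> \<not> s ! i)"

text \<open>The window moves by one cell: bit 0 is dropped, and position 18 enters, where nothing
  but the new tile can set a bit.\<close>

definition advance :: "nat set \<Rightarrow> bool list \<Rightarrow> bool list" where
  "advance D s = map (\<lambda>i. i < 18 \<and> s ! i \<or> i \<in> D) [1..<19]"

text \<open>All ways to complete a column, starting from the state \<open>s\<close>, must end in a state whose value is
  below \<open>c\<close> plus 17 for every monomino used.\<close>

fun column_ok :: "trie \<Rightarrow> nat set list list \<Rightarrow> nat \<Rightarrow> bool list \<Rightarrow> bool" where
  "column_ok t [] c s = (case lookup t (rev s) of None \<Rightarrow> False | Some v \<Rightarrow> v < c)"
| "column_ok t (Ds # rs) c s =
     (if hd s then column_ok t rs c (advance {} s)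
      else (\<forall>D\<in>set Ds. fits D s \<longrightarrow> column_ok t rs c (advance D s)) \<and>
           column_ok t rs (c + 17) (advance {0} s))"

text \<open>The bits of the path are consed onto \<open>s\<close>. Since keys are stored reversed,
  the list is the state in column order once a leaf is reached, ready for
  \<open>column_ok\<close>.\<close>

fun all_columns_ok :: "trie \<Rightarrow> trie \<Rightarrow> bool list \<Rightarrow> bool" where
  "all_columns_ok t (V v) s = column_ok t rows v s"
| "all_columns_ok t (F l) s = all_columns_ok t l (False # s)"
| "all_columns_ok t (T r) s = all_columns_ok t r (True # s)"
| "all_columns_ok t (B l r) s = (all_columns_ok t l (False # s) \<and> all_columns_ok t r (True # s))"

lemma all_columns_ok_lookup:
  assumes "all_columns_ok t u s" "lookup u q = Some v"
  shows "column_ok t rows v (rev q @ s)"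
  using assms
  by (induction t u s arbitrary: q rule: all_columns_ok.induct) (case_tac q; auto split: if_splits)+

section \<open>The column order of cells and the offsets of a tile\<close>

fun cell_index :: "cell \<Rightarrow> int" where
  "cell_index (x, y) = 9 * y + x"

lemma inj_on_cell_index: "inj_on cell_index (rectangle 9 n)"
  by (rule inj_onI) (clarsimp simp: rectangle_def, presburger)

text \<open>The extreme case is a bar along the strip: its ends are two columns, that is 2 * 9
  positions, apart. This is the reason for the 18 bits of a state.\<close>

lemma T_tetromino_spread:
  assumes "is_T_tetromino t" "c \<in> t" "d \<in> t"
  shows "cell_index c \<le> cell_index d + 18"
  using assms(1)
proof (rule T_tetromino_cases)
  fix h x y s assume "s \<in> {1, -1}" "t = set (T_cells (h, x, y, s))"
  with assms(2,3) show ?thesis by (auto split: if_splits)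
qed

text \<open>Offsets alone would wrap around the border: from row 8, offset 10 is row 0 two columns
  later. Containment in the rectangle excludes this, and the resulting bounds on \<open>x\<close>
  are exactly those encoded in \<open>rows\<close>.\<close>

lemma T_tetromino_shape:
  assumes "is_T_tetromino t" "t \<subseteq> rectangle 9 n" "(int x, int y) \<in> t" "x < 9"
    and min: "\<And>d. d \<in> t \<Longrightarrow> int (9 * y + x) \<le> cell_index d"
  shows "\<exists>D\<in>set (rows ! x). cell_index ` t = (\<lambda>i. int (9 * y + x + i)) ` D"
proof -
  obtain h a b s where s: "s \<in> {1, -1}" and t: "t = set (T_cells (h, a, b, s))"
    using assms(1) by (rule T_tetromino_cases)
  have row1: "tshape1 \<in> set (rows ! x)" if "x < 8"
    using that by (auto simp: rows_def less_Suc_eq numeral_eq_Suc nth_Cons')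
  have row2: "tshape2 \<in> set (rows ! x)" if "0 < x"
    using that \<open>x < 9\<close> by (auto simp: rows_def less_Suc_eq numeral_eq_Suc nth_Cons')
  have row3: "tshape3 \<in> set (rows ! x)" if "x < 7"
    using that by (auto simp: rows_def less_Suc_eq numeral_eq_Suc nth_Cons')
  have row4: "tshape4 \<in> set (rows ! x)" if "0 < x" "x < 8"
    using that by (auto simp: rows_def less_Suc_eq numeral_eq_Suc nth_Cons')
  consider "h" "s = 1" | "h" "s = -1" | "\<not> h" "s = 1" | "\<not> h" "s = -1" using s by blast
  then show ?thesis
  proof cases
    case 1
    \<comment> \<open>The cell \<open>(a, b)\<close> comes first in this orientation, so minimality
      of \<open>(x, y)\<close> identifies the two.\<close>
    with assms(2,3) min[of "(a, b)"] t have "a = int x" "b = int y" "x < 8"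
      by (auto simp: rectangle_def)
    with 1 t row1 show ?thesis by (intro bexI[of _ tshape1]) (auto simp: tshape_defs)
  next
    case 2
    with assms(2,3) min[of "(a, b)"] t have "a = int x" "b = int y" "0 < x"
      by (auto simp: rectangle_def)
    with 2 t row2 show ?thesis by (intro bexI[of _ tshape2]) (auto simp: tshape_defs)
  next
    case 3
    with assms(2,3) min[of "(a, b)"] t have "a = int x" "b = int y" "x < 7"
      by (auto simp: rectangle_def)
    with 3 t row3 show ?thesis by (intro bexI[of _ tshape3]) (auto simp: tshape_defs)
  next
    case 4
    \<comment> \<open>Here the stem points backwards and is the first cell, one column before the
      bar.\<close>
    with assms(2,3) min[of "(a + 1, b - 1)"] t have "a = int x - 1" "b = int y + 1" "0 < x" "x < 8"
      by (auto simp: rectangle_def)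
    with 4 t row4 show ?thesis by (intro bexI[of _ tshape4]) (auto simp: tshape_defs)
  qed
qed

section \<open>Reading a tiling cell by cell\<close>

locale strip_tiling =
  fixes n :: nat and P :: "cell set set"
  assumes tiling: "is_tiling 9 n P"
begin

text \<open>A tile counts as placed as soon as its first cell has been passed; from then on all its
  cells, including those still ahead, belong to \<open>occ\<close>.\<close>

definition seen :: "nat \<Rightarrow> cell set set" where
  "seen k = {t \<in> P. \<exists>d\<in>t. cell_index d < int k}"

definition occ :: "nat \<Rightarrow> int set" where
  "occ k = cell_index ` \<Union>(seen k)"

text \<open>The window starts at the current cell. For \<open>k\<close> a multiple of 9 this is the
  state before a column; the other values of \<open>k\<close> are the intermediate lists met by
  \<open>column_ok\<close>.\<close>

definition state :: "nat \<Rightarrow> bool list" where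
  "state k = map (\<lambda>i. int (k + i) \<in> occ k) [0..<18]"

definition singles :: "nat \<Rightarrow> nat" where
  "singles k = card {t \<in> seen k. is_monomino t}"

lemma finite_P: "finite P"
  using tiling by (rule is_tiling_finite)

lemma finite_seen: "finite (seen k)"
  using finite_P by (simp add: seen_def)

lemma tile_subset: "t \<in> P \<Longrightarrow> t \<subseteq> rectangle 9 n"
  using tiling unfolding is_tiling_def by (auto dest: partition_onD1)

lemma tile_cases: "t \<in> P \<Longrightarrow> is_T_tetromino t \<or> is_monomino t"
  using tiling unfolding is_tiling_def by blast

lemma tile_unique:
  assumes "t \<in> P" "u \<in> P" "c \<in> t" "d \<in> u" "cell_index c = cell_index d"
  shows "t = u"
proof -
  have "c = d" using assms tile_subset inj_onD[OF inj_on_cell_index[of n], of c d] by blast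
  then show ?thesis using assms tiling unfolding is_tiling_def
    by (metis IntI disjointD empty_iff partition_onD2)
qed

text \<open>A placed tile has a cell of index at most \<open>k - 1\<close> and extends at most 18
  further, so the window \<open>k, ..., k + 17\<close> contains every covered cell that is still
  ahead.\<close>

lemma occ_bound:
  assumes "i \<in> occ k"
  shows "i < int k + 18"
proof -
  obtain t c d where t: "t \<in> P" "c \<in> t" "d \<in> t" "cell_index d < int k" "i = cell_index c"
    using assms by (auto simp: occ_def seen_def)
  have "cell_index c \<le> cell_index d + 18"
    using tile_cases[OF t(1)]
  proof
    assume "is_T_tetromino t"
    then show ?thesis using t(2,3) by (rule T_tetromino_spread)
  next
    assume "is_monomino t"
    then show ?thesis using t(2,3) by (auto simp: is_monomino_def)
  qed
  with t show ?thesis by simp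
qed

lemma state_Suc:
  assumes "occ (Suc k) = occ k \<union> (\<lambda>i. int (k + i)) ` D"
  shows "state (Suc k) = advance D (state k)"
proof (rule nth_equalityI)
  show "length (state (Suc k)) = length (advance D (state k))" by (simp add: state_def advance_def)
  fix j assume "j < length (state (Suc k))"
  then have j: "j < 18" by (simp add: state_def)
  \<comment> \<open>The position that enters the window was not covered before, so its bit depends
    on \<open>D\<close> alone.\<close>
  have out: "int (k + 18) \<notin> occ k" using occ_bound by fastforce
  have "int (k + Suc j) \<in> occ k \<longleftrightarrow> Suc j < 18 \<and> state k ! Suc j"
  proof (cases "Suc j < 18")
    case True
    then show ?thesis by (simp add: state_def algebra_simps del: upt_Suc)
  next
    case False
    with j have "Suc j = 18" by simp
    with out show ?thesis by simp
  qed
  moreover have "int (k + Suc j) \<in> (\<lambda>i. int (k + i)) ` D \<longleftrightarrow> Suc j \<in> D"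
    unfolding image_iff of_nat_eq_iff by auto
  ultimately show "state (Suc k) ! j = advance D (state k) ! j"
    using j assms by (simp add: state_def[of "Suc k"] advance_def del: upt_Suc)
qed

lemma hd_state: "hd (state k) \<longleftrightarrow> int k \<in> occ k"
  by (simp add: state_def upt_rec)

text \<open>The tile at position \<open>k\<close> is already placed, and by disjointness no other
  tile has a cell there; passing the cell therefore adds nothing to \<open>seen\<close>.\<close>

lemma step_covered:
  assumes "hd (state k)"
  shows "state (Suc k) = advance {} (state k)" "singles (Suc k) = singles k"
proof -
  obtain t c where t: "t \<in> seen k" "c \<in> t" "cell_index c = int k"
    using assms unfolding hd_state occ_def by fastforce
  have "seen (Suc k) = seen k"
  proof
    show "seen (Suc k) \<subseteq> seen k"
    proof
      fix u assume "u \<in> seen (Suc k)"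
      then obtain d where d: "u \<in> P" "d \<in> u" "cell_index d \<le> int k" by (auto simp: seen_def)
      show "u \<in> seen k"
      proof (cases "cell_index d = int k")
        case True
        then have "u = t" using tile_unique[of u t d c] d t by (auto simp: seen_def)
        with t show ?thesis by simp
      next
        case False
        with d show ?thesis by (auto simp: seen_def intro!: bexI[of _ d])
      qed
    qed
  qed (force simp: seen_def)
  then show "state (Suc k) = advance {} (state k)" "singles (Suc k) = singles k"
    by (auto intro: state_Suc simp: occ_def singles_def)
qed

text \<open>The tile at an uncovered cell is new, so this cell is its first one. Hence its
  orientation is among those offered by \<open>rows\<close>, and disjointness from the placed tiles
  gives \<open>fits\<close>; otherwise it is a monomino, which takes offset 0 only.\<close>

lemma step_uncovered:
  assumes "\<not> hd (state (9 * y + x))" "x < 9" "y < n"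
  defines "k \<equiv> 9 * y + x"
  shows "(\<exists>D\<in>set (rows ! x). fits D (state k) \<and> state (Suc k) = advance D (state k) \<and> singles (Suc k) = singles k)
         \<or> state (Suc k) = advance {0} (state k) \<and> singles (Suc k) = Suc (singles k)"
proof -
  have "(int x, int y) \<in> \<Union>P"
    using tiling assms(2,3) by (auto simp: is_tiling_def rectangle_def dest!: partition_onD1[symmetric])
  then obtain t where t: "t \<in> P" "(int x, int y) \<in> t" by blast
  have k: "cell_index (int x, int y) = int k" by (simp add: k_def)
  have new: "t \<notin> seen k"
    using assms(1) t(2) k unfolding hd_state k_def[symmetric] occ_def by force
  \<comment> \<open>A cell of \<open>t\<close> before position \<open>k\<close> would put
    \<open>t\<close> into \<open>seen k\<close>.\<close>
  then have min: "int k \<le> cell_index d" if "d \<in> t" for d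
    using that t(1) by (force simp: seen_def)
  have seen_Suc: "seen (Suc k) = insert t (seen k)"
  proof
    show "insert t (seen k) \<subseteq> seen (Suc k)"
      using t k by (force simp: seen_def)
    show "seen (Suc k) \<subseteq> insert t (seen k)"
    proof
      fix u assume "u \<in> seen (Suc k)"
      then obtain d where d: "u \<in> P" "d \<in> u" "cell_index d \<le> int k" by (auto simp: seen_def)
      show "u \<in> insert t (seen k)"
      proof (cases "cell_index d = int k")
        case True
        then show ?thesis using tile_unique[OF d(1) t(1) d(2) t(2)] k by simp
      next
        case False
        with d show ?thesis by (auto simp: seen_def intro!: bexI[of _ d])
      qed
    qed
  qed
  then have occ_Suc: "occ (Suc k) = occ k \<union> cell_index ` t" by (auto simp: occ_def)
  have apart: "cell_index d \<notin> occ k" if "d \<in> t" for d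
    using tile_unique[OF t(1) _ that] new by (auto simp: occ_def seen_def)
  show ?thesis
  proof (cases "is_monomino t")
    case True
    then have "t = {(int x, int y)}" using t(2) by (auto simp: is_monomino_def)
    then have "occ (Suc k) = occ k \<union> (\<lambda>i. int (k + i)) ` {0}" using occ_Suc k by simp
    moreover have "{u \<in> seen (Suc k). is_monomino u} = insert t {u \<in> seen k. is_monomino u}"
      using True seen_Suc by auto
    then have "singles (Suc k) = Suc (singles k)"
      using new finite_seen by (simp add: singles_def)
    ultimately show ?thesis using state_Suc by blast
  next
    case False
    then have "is_T_tetromino t" using tile_cases t(1) by blast
    then obtain D where D: "D \<in> set (rows ! x)" "cell_index ` t = (\<lambda>i. int (k + i)) ` D"
      using T_tetromino_shape[OF _ tile_subset[OF t(1)] t(2) assms(2)] min unfolding k_def by blast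
    have "fits D (state k)"
      unfolding fits_def
    proof (intro ballI impI)
      fix i assume "i \<in> D" "i < 18"
      then obtain d where "d \<in> t" "cell_index d = int (k + i)" using D(2) by (metis imageE imageI)
      then show "\<not> state k ! i" using apart[of d] \<open>i < 18\<close> by (simp add: state_def)
    qed
    moreover have "{u \<in> seen (Suc k). is_monomino u} = {u \<in> seen k. is_monomino u}"
      using False seen_Suc by auto
    then have "singles (Suc k) = singles k" by (simp add: singles_def)
    ultimately show ?thesis using D state_Suc occ_Suc by metis
  qed
qed

text \<open>Along the actual tiling, the allowance \<open>c\<close> of \<open>column_ok\<close>
  grows by 17 exactly when \<open>singles\<close> grows by 1, so \<open>c - 17 * singles\<close> is
  invariant; it is written with sums to stay within the naturals. The strict inequality at the end
  of the column is the one unit paid back per column.\<close>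

lemma column_ok_run:
  assumes "column_ok t (drop x rows) c (state (9 * y + x))" "x \<le> 9" "y < n"
  shows "\<exists>v. lookup t (rev (state (9 * Suc y))) = Some v \<and> v + 17 * singles (9 * y + x) < c + 17 * singles (9 * Suc y)"
  using assms(1,2)
proof (induction "9 - x" arbitrary: x c)
  case 0
  then have "x = 9" by simp
  moreover have "drop 9 rows = []" by (simp add: rows_def)
  ultimately show ?case using 0 by (simp split: option.splits add: algebra_simps)
next
  case (Suc m)
  then have x: "x < 9" by simp
  have "drop x rows = rows ! x # drop (Suc x) rows"
    by (rule Cons_nth_drop_Suc[symmetric]) (use x in \<open>simp add: rows_def\<close>)
  note ok = Suc.prems(1)[unfolded this column_ok.simps]
  \<comment> \<open>Each kind of step only has to supply the next allowance \<open>c'\<close> and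
    show that its growth is matched by new monominos.\<close>
  have IH: ?case if "column_ok t (drop (Suc x) rows) c' (state (Suc (9 * y + x)))"
    "c' + 17 * singles (9 * y + x) \<le> c + 17 * singles (Suc (9 * y + x))" for c'
    using Suc.hyps(1)[of "Suc x" c'] Suc.hyps(2) that x by fastforce
  show ?case
  proof (cases "hd (state (9 * y + x))")
    case True
    with ok step_covered show ?thesis by (intro IH[of c]) simp_all
  next
    case False
    from step_uncovered[OF False x assms(3)] show ?thesis
    proof
      assume "\<exists>D\<in>set (rows ! x). fits D (state (9 * y + x)) \<and>
        state (Suc (9 * y + x)) = advance D (state (9 * y + x)) \<and>
        singles (Suc (9 * y + x)) = singles (9 * y + x)"
      with ok False show ?thesis by (intro IH[of c]) auto
    next
      assume "state (Suc (9 * y + x)) = advance {0} (state (9 * y + x)) \<and>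
        singles (Suc (9 * y + x)) = Suc (singles (9 * y + x))"
      with ok False show ?thesis by (intro IH[of "c + 17"]) auto
    qed
  qed
qed

text \<open>The column inequalities telescope. That the current state is listed is part of the
  induction, since a successful \<open>column_ok\<close> guarantees it for the next column.\<close>

lemma potential_bound:
  assumes "all_columns_ok t t []" "lookup t (replicate 18 False) = Some v\<^sub>0" "y \<le> n"
  shows "\<exists>v. lookup t (rev (state (9 * y))) = Some v \<and> v + y \<le> v\<^sub>0 + 17 * singles (9 * y)"
  using assms(3)
proof (induction y)
  case 0
  \<comment> \<open>All indices in the rectangle are nonnegative, so nothing is placed before
    position 0 and the first state is empty.\<close>
  have "cell_index d \<ge> 0" if "u \<in> P" "d \<in> u" for u d
    using that tile_subset by (force simp: rectangle_def)
  then have "seen 0 = {}" by (force simp: seen_def)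
  then have "state 0 = replicate 18 False" "singles 0 = 0"
    by (auto simp: state_def occ_def singles_def list_eq_iff_nth_eq)
  with assms(2) show ?case by simp
next
  case (Suc y)
  then obtain v where v: "lookup t (rev (state (9 * y))) = Some v" "v + y \<le> v\<^sub>0 + 17 * singles (9 * y)"
    by auto
  \<comment> \<open>The terms \<open>drop 0\<close> and \<open>+ 0\<close> present the start of a
    column as the case \<open>x = 0\<close> of \<open>column_ok_run\<close>.\<close>
  have "column_ok t (drop 0 rows) v (state (9 * y + 0))"
    using all_columns_ok_lookup[OF assms(1) v(1)] by simp
  from column_ok_run[OF this] Suc.prems v(2) show ?case by force
qed

lemma singles_le: "singles k \<le> num_monominos P"
  unfolding singles_def num_monominos_def
  by (rule card_mono) (use finite_P in \<open>auto simp: seen_def\<close>)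

end

lemma gap_number_9_ge:
  assumes "all_columns_ok t t []" "lookup t (replicate 18 False) = Some v\<^sub>0"
  shows "n \<le> v\<^sub>0 + 17 * gap_number 9 n"
proof -
  obtain P where P: "is_tiling 9 n P" "num_monominos P = gap_number 9 n"
    using gap_number_attained by blast
  interpret strip_tiling n P by standard (rule P(1))
  show ?thesis
    using potential_bound[OF assms order.refl] singles_le[of "9 * n"] P(2) by fastforce
qed


section \<open>The potential\<close>

text \<open>The value of a state is 7 plus the least charge (17 per monomino, -1 per column) of all partial
  tilings that reach it from an empty strip.\<close>

definition "pot0 =
    B (B (B (B (B (B (B (V 7) (V 28)) (F (V 20))) (B (B (V 20) (V 13)) (B (V 13) (V 30)))) (B (B
     (B (V 20) (V 17)) (F (V 21))) (B (F (V 13)) (B (V 34) (V 23))))) (B (B (B (B (V 28) (V 21))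
     (F (V 17))) (B (B (V 29) (V 26)) (B (V 34) (V 15)))) (B (B (B (V 45) (V 34)) (F (V 34))) (B
     (B (V 26) (V 27)) (B (V 23) (V 24)))))) (B (B (B (B (B (V 20) (V 33)) (F (V 21))) (B (B (V
     21) (V 26)) (B (V 26) (V 39)))) (B (B (B (V 41) (V 26)) (F (V 26))) (B (F (V 30)) (B (V 39)
     (V 24))))) (B (B (B (B (V 45) (V 22)) (F (V 38))) (B (F (V 34)) (T (V 40)))) (B (B (B (V 26)
     (V 35)) (F (V 23))) (B (B (V 19) (V 24)) (B (V 16) (V 29))))))) (B (B (B (B (B (B (V 20) (V
     21)) (F (V 17))) (B (B (V 21) (V 30)) (B (V 30) (V 15)))) (B (B (B (V 21) (V 14)) (F (V
     22))) (B (F (V 18)) (B (V 27) (V 4))))) (B (B (B (B (V 29) (V 18)) (F (V 26))) (B (B (V 30)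
     (V 11)) (B (V 19) (V 16)))) (B (B (B (V 34) (V 27)) (F (V 19))) (B (B (V 19) (V 20)) (B (V
     20) (V 17)))))) (B (B (B (B (B (V 13) (V 30)) (F (V 18))) (B (B (V 18) (V 19)) (B (V 19) (V
     36)))) (B (B (B (V 30) (V 23)) (F (V 19))) (T (B (V 40) (V 13))))) (B (B (B (B (V 26) (V
     31)) (F (V 19))) (B (B (V 19) (V 24)) (B (V 20) (V 25)))) (B (B (B (V 19) (V 24)) (F (V
     24))) (B (B (V 4) (V 17)) (B (V 17) (V 22)))))))"

definition "pot1 =
    B (B (B (B (B (B (B (V 20) (V 21)) (F (V 21))) (B (B (V 17) (V 26)) (B (V 26) (V 23)))) (B
     (B (B (V 21) (V 26)) (F (V 18))) (B (F (V 18)) (B (V 39) (V 24))))) (B (B (B (B (V 17) (V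
     22)) (F (V 6))) (B (B (V 26) (V 19)) (B (V 19) (V 12)))) (B (B (B (V 38) (V 15)) (F (V 15)))
     (B (B (V 19) (V 24)) (B (V 32) (V 21)))))) (B (B (B (B (B (V 21) (V 26)) (F (V 18))) (B (B
     (V 22) (V 11)) (B (V 19) (V 32)))) (B (B (B (V 26) (V 19)) (F (V 19))) (B (F (V 19)) (B (V
     40) (V 21))))) (B (B (B (B (V 34) (V 11)) (F (V 15))) (B (F (V 19)) (T (V 21)))) (B (B (B (V
     23) (V 36)) (F (V 36))) (B (B (V 24) (V 13)) (B (V 25) (V 26))))))) (B (B (B (B (B (B (V 13)
     (V 30)) (F (V 26))) (B (B (V 30) (V 19)) (B (V 3) (V 32)))) (B (B (B (V 26) (V 19)) (F (V
     19))) (B (F (V 19)) (B (V 40) (V 17))))) (B (B (B (B (V 34) (V 15)) (F (V 19))) (B (F (V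
     19)) (T (V 21)))) (T (B (B (V 20) (V 33)) (B (V 21) (V 34)))))) (B (B (B (B (B (V 34) (V
     35)) (F (V 39))) (B (B (V 27) (V 40)) (B (V 40) (V 29)))) (B (B (B (V 39) (V 40)) (F (V
     40))) (B (F (V 40)) (B (V 61) (V 34))))) (B (B (B (B (V 23) (V 32)) (F (V 32))) (B (B (V 20)
     (V 21)) (B (V 21) (V 26)))) (B (B (B (V 16) (V 21)) (F (V 25))) (B (B (V 17) (V 26)) (B (V
     26) (V 23)))))))"

definition "pot2 =
    B (B (B (B (B (B (B (V 28) (V 5)) (F (V 21))) (B (B (V 21) (V 30)) (B (V 30) (V 23)))) (B (B
     (B (V 33) (V 18)) (F (V 26))) (B (F (V 30)) (B (V 35) (V 24))))) (B (B (B (B (V 21) (V 22))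
     (F (V 22))) (B (B (V 18) (V 19)) (B (V 15) (V 20)))) (B (B (B (V 22) (V 11)) (F (V 11))) (B
     (B (V 31) (V 28)) (B (V 32) (V 21)))))) (B (B (B (B (B (V 17) (V 18)) (F (V 26))) (B (B (V
     14) (V 23)) (B (V 19) (V 32)))) (B (B (B (V 26) (V 19)) (F (V 19))) (B (F (V 23)) (B (V 40)
     (V 21))))) (B (B (B (B (V 34) (V 11)) (F (V 15))) (B (F (V 27)) (T (V 21)))) (B (B (B (V 35)
     (V 48)) (F (V 36))) (B (B (V 24) (V 21)) (B (V 21) (V 18))))))) (B (B (B (B (B (B (V 13) (V
     30)) (F (V 26))) (B (B (V 30) (V 19)) (B (V 19) (V 24)))) (B (B (B (V 26) (V 23)) (F (V
     11))) (B (F (V 19)) (B (V 40) (V 17))))) (B (B (B (B (V 26) (V 19)) (F (V 19))) (B (F (V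
     11)) (T (V 21)))) (T (B (B (V 24) (V 21)) (B (V 21) (V 34)))))) (T (B (B (B (B (V 27) (V
     28)) (F (V 24))) (B (B (V 20) (V 21)) (B (V 33) (V 26)))) (B (B (B (V 24) (V 21)) (F (V
     13))) (B (B (V 17) (V 30)) (B (V 26) (V 31)))))))"

definition "pot3 =
    T (B (B (B (B (B (B (V 30) (V 23)) (F (V 23))) (B (B (V 15) (V 24)) (B (V 32) (V 29)))) (B
     (B (B (V 39) (V 32)) (F (V 32))) (B (F (V 36)) (B (V 29) (V 30))))) (B (B (B (B (V 15) (V
     20)) (F (V 12))) (B (B (V 16) (V 21)) (B (V 21) (V 18)))) (B (B (B (V 40) (V 21)) (F (V
     21))) (B (B (V 25) (V 26)) (B (V 26) (V 27)))))) (B (B (B (B (B (V 23) (V 24)) (F (V 24)))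
     (B (B (V 4) (V 17)) (B (V 17) (V 30)))) (B (B (B (V 24) (V 21)) (F (V 21))) (B (F (V 13)) (B
     (V 34) (V 27))))) (B (B (B (B (V 24) (V 21)) (F (V 21))) (B (B (V 17) (V 34)) (B (V 34) (V
     27)))) (B (B (B (V 29) (V 18)) (F (V 26))) (B (B (V 22) (V 31)) (B (V 23) (V 24)))))))"

definition "pot4 =
    B (B (B (B (B (B (B (T (T (V 22))) (T (T (V 23)))) (B (T (T (V 23))) (T (T (V 20))))) (B (B
     (T (T (V 19))) (T (T (V 28)))) (B (T (T (V 28))) (T (T (V 33)))))) (B (B (B (T (T (V 39)))
     (T (T (V 32)))) (B (T (T (V 24))) (T (T (V 49))))) (B (B (T (T (V 32))) (T (T (V 49)))) (B
     (T (T (V 29))) (T (T (V 22))))))) (B (B (B (B (T (T (V 23))) (T (T (V 20)))) (B (T (T (V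
     20))) (T (T (V 37))))) (B (B (T (T (V 16))) (T (T (V 17)))) (B (T (T (V 21))) (T (T (V
     14)))))) (B (B (B (T (T (V 36))) (T (T (V 17)))) (F (T (T (V 17))))) (B (B (T (T (V 25))) (T
     (T (V 14)))) (B (T (T (V 22))) (T (T (V 23)))))))) (B (B (B (B (B (T (T (V 15))) (T (T (V
     32)))) (B (T (T (V 20))) (T (T (V 37))))) (B (B (T (T (V 12))) (T (T (V 25)))) (B (T (T (V
     21))) (T (T (V 26)))))) (B (B (B (T (T (V 24))) (T (T (V 25)))) (B (T (T (V 13))) (T (T (V
     34))))) (B (B (T (T (V 21))) (T (T (V 26)))) (B (T (T (V 38))) (T (T (V 19))))))) (B (B (B
     (B (T (T (V 20))) (T (T (V 21)))) (B (T (T (V 29))) (T (T (V 26))))) (B (B (T (T (V 25))) (T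
     (T (V 34)))) (T (T (T (V 27)))))) (B (B (B (T (T (V 37))) (T (T (V 50)))) (B (T (T (V 34)))
     (T (T (V 47))))) (B (B (T (T (V 22))) (T (T (V 23)))) (B (T (T (V 19))) (T (T (V 16)))))))))
     (B (B (B (B (B (B (T (T (V 15))) (T (T (V 32)))) (B (T (T (V 28))) (T (T (V 49))))) (B (B (T
     (T (V 20))) (T (T (V 21)))) (B (T (T (V 5))) (T (T (V 26)))))) (B (B (B (T (T (V 28))) (T (T
     (V 21)))) (B (T (T (V 21))) (T (T (V 30))))) (B (B (T (T (V 21))) (T (T (V 34)))) (B (T (T
     (V 42))) (T (T (V 19))))))) (B (B (B (B (T (T (V 32))) (T (T (V 21)))) (B (T (T (V 21))) (T
     (T (V 26))))) (B (B (T (T (V 21))) (T (T (V 34)))) (T (T (T (V 23)))))) (T (B (B (T (T (V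
     22))) (T (T (V 27)))) (B (T (T (V 31))) (T (T (V 24)))))))) (T (B (B (B (B (T (T (V 25))) (T
     (T (V 26)))) (B (T (T (V 26))) (T (T (V 47))))) (B (B (T (T (V 18))) (T (T (V 23)))) (B (T
     (T (V 23))) (T (T (V 32)))))) (B (B (B (T (T (V 18))) (T (T (V 23)))) (B (T (T (V 19))) (T
     (T (V 36))))) (B (B (T (T (V 19))) (T (T (V 28)))) (B (T (T (V 28))) (T (T (V 29)))))))))"

definition "pot5 =
    B (B (B (B (B (B (T (T (V 30))) (T (B (V 30) (V 23)))) (B (T (T (V 23))) (T (F (V 23))))) (B
     (B (T (T (V 15))) (T (B (V 15) (V 32)))) (B (T (T (V 32))) (T (B (V 32) (V 33)))))) (B (B (B
     (T (T (V 39))) (T (B (V 39) (V 20)))) (B (T (T (V 32))) (T (F (V 32))))) (B (B (T (T (V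
     40))) (T (F (V 40)))) (B (T (T (V 29))) (T (B (V 29) (V 22))))))) (B (B (B (B (T (T (V 15)))
     (T (B (V 15) (V 20)))) (B (T (T (V 4))) (T (F (V 4))))) (B (B (T (T (V 16))) (T (B (V 16) (V
     29)))) (B (T (T (V 17))) (T (B (V 17) (V 18)))))) (B (B (B (T (T (V 36))) (T (B (V 36) (V
     13)))) (B (T (T (V 13))) (T (F (V 13))))) (B (B (T (T (V 25))) (T (B (V 25) (V 30)))) (B (T
     (T (V 22))) (T (B (V 22) (V 23)))))))) (B (B (B (B (B (T (T (V 23))) (T (B (V 23) (V 20))))
     (B (T (T (V 32))) (T (F (V 32))))) (B (B (T (T (V 12))) (T (B (V 12) (V 17)))) (B (T (T (V
     21))) (T (B (V 21) (V 22)))))) (B (B (B (T (T (V 32))) (T (B (V 32) (V 21)))) (B (T (T (V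
     21))) (T (F (V 21))))) (B (B (T (T (V 21))) (T (F (V 21)))) (B (T (T (V 42))) (T (B (V 42)
     (V 23))))))) (B (B (B (B (T (T (V 32))) (T (B (V 32) (V 13)))) (B (T (T (V 17))) (T (F (V
     17))))) (B (B (T (T (V 21))) (T (F (V 21)))) (T (T (T (V 27)))))) (B (B (B (T (T (V 29))) (T
     (B (V 29) (V 34)))) (B (T (T (V 34))) (T (F (V 34))))) (B (B (T (T (V 26))) (T (B (V 26) (V
     23)))) (B (T (T (V 23))) (T (B (V 23) (V 20))))))))"

definition "pot6 =
    B (B (B (B (B (B (T (T (V 23))) (T (B (V 23) (V 36)))) (B (T (T (V 32))) (T (F (V 32))))) (B
     (B (T (T (V 20))) (T (B (V 20) (V 21)))) (B (T (T (V 21))) (T (B (V 21) (V 22)))))) (B (B (B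
     (T (T (V 32))) (T (B (V 32) (V 17)))) (B (T (T (V 21))) (T (F (V 21))))) (B (B (T (T (V
     21))) (T (F (V 21)))) (B (T (T (V 42))) (T (B (V 42) (V 31))))))) (B (B (B (B (T (T (V 24)))
     (T (B (V 24) (V 13)))) (B (T (T (V 17))) (T (F (V 17))))) (B (B (T (T (V 21))) (T (F (V
     21)))) (T (T (T (V 23)))))) (T (B (B (T (T (V 26))) (T (B (V 26) (V 27)))) (B (T (T (V 31)))
     (T (B (V 31) (V 28)))))))) (T (B (B (B (B (T (T (V 29))) (T (B (V 29) (V 30)))) (B (T (T (V
     30))) (T (F (V 30))))) (B (B (T (T (V 18))) (T (B (V 18) (V 15)))) (B (T (T (V 27))) (T (B
     (V 27) (V 20)))))) (B (B (B (T (T (V 30))) (T (B (V 30) (V 23)))) (B (T (T (V 27))) (T (F (V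
     27))))) (B (B (T (T (V 27))) (T (B (V 27) (V 28)))) (B (T (T (V 32))) (T (B (V 32) (V
     21))))))))"

definition "pot7 =
    B (B (B (B (B (T (T (B (V 34) (V 27)))) (T (B (B (V 34) (V 27)) (B (V 31) (V 28))))) (B (T
     (T (B (V 39) (V 24)))) (T (B (B (V 39) (V 24)) (F (V 28)))))) (B (B (T (T (B (V 39) (V
     24)))) (T (B (B (V 39) (V 24)) (B (V 20) (V 45))))) (B (T (T (B (V 52) (V 45)))) (T (B (B (V
     52) (V 45)) (B (V 37) (V 18))))))) (B (B (B (T (T (B (V 27) (V 4)))) (T (B (B (V 27) (V 4))
     (B (V 20) (V 25))))) (B (T (T (B (V 40) (V 17)))) (T (B (B (V 40) (V 17)) (F (V 29)))))) (B
     (B (T (T (B (V 40) (V 13)))) (T (B (B (V 40) (V 13)) (F (V 13))))) (B (T (T (B (V 37) (V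
     22)))) (T (B (B (V 37) (V 22)) (B (V 26) (V 27)))))))) (B (B (B (B (T (T (B (V 39) (V 24))))
     (T (B (B (V 39) (V 24)) (B (V 20) (V 25))))) (B (T (T (B (V 36) (V 21)))) (T (B (B (V 36) (V
     21)) (F (V 29)))))) (B (B (T (T (B (V 40) (V 21)))) (T (B (B (V 40) (V 21)) (B (V 21) (V
     26))))) (B (T (T (B (V 41) (V 26)))) (T (B (B (V 41) (V 26)) (B (V 34) (V 23))))))) (B (B (B
     (T (T (B (V 40) (V 17)))) (T (B (B (V 40) (V 17)) (B (V 33) (V 30))))) (B (T (T (B (V 41) (V
     34)))) (T (B (B (V 41) (V 34)) (F (V 34)))))) (B (B (T (T (B (V 61) (V 38)))) (T (B (B (V
     61) (V 38)) (B (V 46) (V 35))))) (B (T (T (B (V 38) (V 27)))) (T (B (B (V 38) (V 27)) (B (V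
     31) (V 24))))))))"

definition "pot8 =
    B (B (B (B (B (T (T (B (V 35) (V 24)))) (T (B (B (V 35) (V 24)) (B (V 28) (V 37))))) (B (T
     (T (B (V 48) (V 21)))) (T (B (B (V 48) (V 21)) (F (V 25)))))) (B (B (T (T (B (V 40) (V
     21)))) (T (B (B (V 40) (V 21)) (B (V 25) (V 18))))) (B (T (T (B (V 41) (V 18)))) (T (B (B (V
     41) (V 18)) (B (V 34) (V 31))))))) (B (B (B (T (T (B (V 40) (V 17)))) (T (B (B (V 40) (V
     17)) (B (V 29) (V 30))))) (B (T (T (B (V 41) (V 34)))) (T (B (B (V 41) (V 34)) (F (V
     26)))))) (T (B (T (T (B (V 42) (V 31)))) (T (B (B (V 42) (V 31)) (B (V 35) (V 16)))))))) (T
     (B (B (B (T (T (B (V 29) (V 30)))) (T (B (B (V 29) (V 30)) (B (V 30) (V 35))))) (B (T (T (B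
     (V 38) (V 31)))) (T (B (B (V 38) (V 31)) (F (V 23)))))) (B (B (T (T (B (V 34) (V 27)))) (T
     (B (B (V 34) (V 27)) (B (V 31) (V 24))))) (B (T (T (B (V 31) (V 24)))) (T (B (B (V 31) (V
     24)) (B (V 24) (V 33))))))))"

definition "pot9 =
    B (B (B (B (B (T (T (T (T (V 25))))) (T (T (T (T (V 22)))))) (B (T (T (T (T (V 22))))) (T (T
     (T (T (V 35))))))) (B (B (T (T (T (T (V 10))))) (T (T (T (T (V 23)))))) (B (T (T (T (T (V
     23))))) (T (T (T (T (V 20)))))))) (B (B (B (T (T (T (T (V 22))))) (T (T (T (T (V 19)))))) (B
     (T (T (T (T (V 23))))) (T (T (T (T (V 24))))))) (B (B (T (T (T (T (V 23))))) (T (T (T (T (V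
     24)))))) (B (T (T (T (T (V 44))))) (T (T (T (T (V 33))))))))) (B (B (B (B (T (T (T (T (V
     18))))) (T (T (T (T (V 31)))))) (B (T (T (T (T (V 23))))) (T (T (T (T (V 24))))))) (B (B (T
     (T (T (T (V 23))))) (T (T (T (T (V 24)))))) (T (T (T (T (T (V 25)))))))) (T (B (B (T (T (T
     (T (V 12))))) (T (T (T (T (V 25)))))) (B (T (T (T (T (V 25))))) (T (T (T (T (V 14)))))))))"

definition "pot10 =
    F (B (B (B (B (B (T (T (T (T (V 17))))) (T (T (T (T (V 22)))))) (B (T (T (T (T (V 30))))) (T
     (T (T (T (V 35))))))) (B (B (T (T (T (T (V 10))))) (T (T (T (T (V 23)))))) (B (T (T (T (T (V
     23))))) (T (T (T (T (V 20)))))))) (B (B (B (T (T (T (T (V 30))))) (T (T (T (T (V 23)))))) (B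
     (T (T (T (T (V 23))))) (T (T (T (T (V 24))))))) (B (B (T (T (T (T (V 23))))) (T (T (T (T (V
     28)))))) (B (T (T (T (T (V 44))))) (T (T (T (T (V 21))))))))) (B (B (B (B (T (T (T (T (V
     18))))) (T (T (T (T (V 31)))))) (B (T (T (T (T (V 27))))) (T (T (T (T (V 24))))))) (B (B (T
     (T (T (T (V 23))))) (T (T (T (T (V 28)))))) (T (T (T (T (T (V 33)))))))) (T (B (B (T (T (T
     (T (V 20))))) (T (T (T (T (V 21)))))) (B (T (T (T (T (V 17))))) (T (T (T (T (V 14))))))))))"

definition "pot11 =
    B (B (B (B (T (T (B (B (V 26) (V 27)) (F (V 23))))) (T (B (B (B (V 26) (V 27)) (F (V 23)))
     (B (B (V 23) (V 28)) (B (V 28) (V 33)))))) (B (T (T (B (B (V 19) (V 24)) (F (V 32))))) (T (B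
     (B (B (V 19) (V 24)) (F (V 32))) (B (F (V 20)) (T (V 22))))))) (B (B (T (T (B (B (V 19) (V
     20)) (F (V 20))))) (T (B (B (B (V 19) (V 20)) (F (V 20))) (B (B (V 20) (V 21)) (B (V 17) (V
     18)))))) (B (T (T (B (B (V 20) (V 17)) (F (V 17))))) (T (B (B (B (V 20) (V 17)) (F (V 17)))
     (B (B (V 13) (V 22)) (B (V 14) (V 23)))))))) (B (B (B (T (T (B (B (V 19) (V 24)) (F (V
     32))))) (T (B (B (B (V 19) (V 24)) (F (V 32))) (B (B (V 20) (V 21)) (B (V 25) (V 22)))))) (B
     (T (T (B (B (V 24) (V 13)) (F (V 25))))) (T (B (B (B (V 24) (V 13)) (F (V 25))) (B (F (V
     21)) (T (V 23))))))) (B (B (T (T (B (B (V 20) (V 33)) (F (V 21))))) (T (B (B (B (V 20) (V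
     33)) (F (V 21))) (B (F (V 13)) (T (V 27)))))) (B (T (T (B (B (V 37) (V 42)) (F (V 50))))) (T
     (B (B (B (V 37) (V 42)) (F (V 50))) (B (B (V 14) (V 27)) (B (V 23) (V 44))))))))"

definition "pot12 =
    B (B (B (B (T (T (B (B (V 31) (V 28)) (F (V 32))))) (T (B (B (B (V 31) (V 28)) (F (V 32)))
     (B (B (V 28) (V 5)) (B (V 21) (V 22)))))) (B (T (T (B (B (V 24) (V 21)) (F (V 21))))) (T (B
     (B (B (V 24) (V 21)) (F (V 21))) (B (F (V 17)) (T (V 31))))))) (B (B (T (T (B (B (V 24) (V
     21)) (F (V 21))))) (T (B (B (B (V 24) (V 21)) (F (V 21))) (B (F (V 13)) (T (V 23)))))) (T (T
     (T (B (B (V 22) (V 31)) (F (V 27)))))))) (T (B (B (T (T (B (B (V 25) (V 26)) (F (V 26)))))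
     (T (B (B (B (V 25) (V 26)) (F (V 26))) (B (B (V 30) (V 23)) (B (V 23) (V 20)))))) (B (T (T
     (B (B (V 22) (V 31)) (F (V 23))))) (T (B (B (B (V 22) (V 31)) (F (V 23))) (B (B (V 23) (V
     28)) (B (V 28) (V 21))))))))"

definition "pot13 =
    B (B (B (B (B (T (T (T (T (V 33))))) (T (B (T (T (V 33))) (T (T (V 30)))))) (B (T (T (T (T
     (V 26))))) (T (B (T (T (V 26))) (T (T (V 43))))))) (B (B (T (T (T (T (V 14))))) (T (B (T (T
     (V 14))) (T (T (V 23)))))) (B (T (T (T (T (V 27))))) (T (B (T (T (V 27))) (T (T (V
     20)))))))) (B (B (B (T (T (T (T (V 26))))) (T (B (T (T (V 26))) (T (T (V 15)))))) (B (T (T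
     (T (T (V 19))))) (T (B (T (T (V 19))) (T (T (V 28))))))) (B (B (T (T (T (T (V 27))))) (T (B
     (T (T (V 27))) (T (T (V 20)))))) (B (T (T (T (T (V 48))))) (T (B (T (T (V 48))) (T (T (V
     29))))))))) (B (B (B (B (T (T (T (T (V 26))))) (T (B (T (T (V 26))) (T (T (V 15)))))) (B (T
     (T (T (T (V 19))))) (T (B (T (T (V 19))) (T (T (V 36))))))) (B (B (T (T (T (T (V 23))))) (T
     (B (T (T (V 23))) (T (T (V 36)))))) (T (T (T (T (T (V 33)))))))) (T (B (B (T (T (T (T (V
     32))))) (T (B (T (T (V 32))) (T (T (V 25)))))) (B (T (T (T (T (V 29))))) (T (B (T (T (V
     29))) (T (T (V 34)))))))))"

definition "pot14 =
    F (B (B (B (B (B (T (T (T (T (V 33))))) (T (B (T (T (V 33))) (T (B (V 33) (V 38)))))) (B (T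
     (T (T (T (V 22))))) (T (B (T (T (V 22))) (T (F (V 22))))))) (B (B (T (T (T (T (V 18))))) (T
     (B (T (T (V 18))) (T (B (V 18) (V 15)))))) (B (T (T (T (T (V 23))))) (T (B (T (T (V 23))) (T
     (B (V 23) (V 20)))))))) (B (B (B (T (T (T (T (V 22))))) (T (B (T (T (V 22))) (T (B (V 22) (V
     23)))))) (B (T (T (T (T (V 23))))) (T (B (T (T (V 23))) (T (F (V 23))))))) (B (B (T (T (T (T
     (V 27))))) (T (B (T (T (V 27))) (T (F (V 27)))))) (B (T (T (T (T (V 44))))) (T (B (T (T (V
     44))) (T (B (V 44) (V 25))))))))) (B (B (B (B (T (T (T (T (V 22))))) (T (B (T (T (V 22))) (T
     (B (V 22) (V 23)))))) (B (T (T (T (T (V 31))))) (T (B (T (T (V 31))) (T (F (V 31))))))) (B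
     (B (T (T (T (T (V 23))))) (T (B (T (T (V 23))) (T (F (V 23)))))) (T (T (T (T (T (V
     33)))))))) (T (B (B (T (T (T (T (V 20))))) (T (B (T (T (V 20))) (T (B (V 20) (V 29)))))) (B
     (T (T (T (T (V 21))))) (T (B (T (T (V 21))) (T (B (V 21) (V 38))))))))))"

definition "pot15 =
    F (F (B (B (B (B (T (T (T (T (B (V 37) (V 18)))))) (T (T (T (T (B (V 38) (V 19))))))) (B (T
     (T (T (T (B (V 38) (V 19)))))) (T (T (T (T (B (V 35) (V 20)))))))) (B (B (T (T (T (T (B (V
     38) (V 19)))))) (T (T (T (T (B (V 35) (V 24))))))) (B (T (T (T (T (B (V 39) (V 28)))))) (T
     (T (T (T (B (V 44) (V 37))))))))) (B (B (B (T (T (T (T (B (V 38) (V 19)))))) (T (T (T (T (B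
     (V 31) (V 24))))))) (F (T (T (T (T (B (V 35) (V 24)))))))) (T (B (T (T (T (T (B (V 40) (V
     21)))))) (T (T (T (T (B (V 21) (V 14)))))))))))"

definition "pot16 =
    B (B (B (T (T (B (B (B (V 26) (V 35)) (F (V 23))) (B (B (V 23) (V 24)) (B (V 16) (V 29))))))
     (T (B (B (B (B (V 26) (V 35)) (F (V 23))) (B (B (V 23) (V 24)) (B (V 16) (V 29)))) (B (B (B
     (V 39) (V 28)) (F (V 20))) (B (B (V 44) (V 41)) (B (V 37) (V 18))))))) (B (T (T (B (B (B (V
     23) (V 36)) (F (V 32))) (B (B (V 4) (V 17)) (B (V 17) (V 34)))))) (T (B (B (B (B (V 23) (V
     36)) (F (V 32))) (B (B (V 4) (V 17)) (B (V 17) (V 34)))) (B (B (B (V 44) (V 25)) (F (V 21)))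
     (T (B (V 34) (V 27)))))))) (B (B (T (T (B (B (B (V 23) (V 36)) (F (V 36))) (B (B (V 32) (V
     21)) (B (V 29) (V 42)))))) (T (B (B (B (B (V 23) (V 36)) (F (V 36))) (B (B (V 32) (V 21)) (B
     (V 29) (V 42)))) (B (B (B (V 20) (V 25)) (F (V 21))) (B (B (V 21) (V 26)) (B (V 26) (V
     23))))))) (B (T (T (B (B (B (V 16) (V 29)) (F (V 29))) (B (B (V 17) (V 26)) (B (V 26) (V
     39)))))) (T (B (B (B (B (V 16) (V 29)) (F (V 29))) (B (B (V 17) (V 26)) (B (V 26) (V 39))))
     (B (B (B (V 37) (V 30)) (F (V 26))) (B (B (V 34) (V 39)) (B (V 39) (V 24))))))))"

definition "pot17 =
    B (B (B (T (T (B (B (B (V 35) (V 48)) (F (V 36))) (B (B (V 36) (V 33)) (B (V 29) (V 42))))))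
     (T (B (B (B (B (V 35) (V 48)) (F (V 36))) (B (B (V 36) (V 33)) (B (V 29) (V 42)))) (B (B (B
     (V 28) (V 37)) (F (V 25))) (B (B (V 25) (V 30)) (B (V 30) (V 31))))))) (B (T (T (B (B (B (V
     24) (V 33)) (F (V 21))) (B (B (V 17) (V 30)) (B (V 26) (V 39)))))) (T (B (B (B (B (V 24) (V
     33)) (F (V 21))) (B (B (V 17) (V 30)) (B (V 26) (V 39)))) (B (B (B (V 41) (V 30)) (F (V
     26))) (T (B (V 39) (V 16)))))))) (T (B (T (T (B (B (B (V 29) (V 42)) (F (V 42))) (B (B (V
     34) (V 39)) (B (V 39) (V 52)))))) (T (B (B (B (B (V 29) (V 42)) (F (V 42))) (B (B (V 34) (V
     39)) (B (V 39) (V 52)))) (B (B (B (V 18) (V 31)) (F (V 23))) (B (B (V 27) (V 16)) (B (V 24)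
     (V 33))))))))"

definition "pot18 =
    B (B (B (B (T (T (B (T (T (V 29))) (T (T (V 22)))))) (T (B (B (T (T (V 29))) (T (T (V 22))))
     (B (T (T (V 22))) (T (T (V 39))))))) (B (T (T (B (T (T (V 34))) (T (T (V 23)))))) (T (B (B
     (T (T (V 34))) (T (T (V 23)))) (F (T (T (V 31)))))))) (B (B (T (T (B (T (T (V 38))) (T (T (V
     19)))))) (T (B (B (T (T (V 38))) (T (T (V 19)))) (B (T (T (V 31))) (T (T (V 32))))))) (B (T
     (T (B (T (T (V 39))) (T (T (V 16)))))) (T (B (B (T (T (V 39))) (T (T (V 16)))) (B (T (T (V
     32))) (T (T (V 33))))))))) (B (B (B (T (T (B (T (T (V 42))) (T (T (V 19)))))) (T (B (B (T (T
     (V 42))) (T (T (V 19)))) (B (T (T (V 35))) (T (T (V 32))))))) (B (T (T (B (T (T (V 39))) (T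
     (T (V 24)))))) (T (B (B (T (T (V 39))) (T (T (V 24)))) (F (T (T (V 32)))))))) (T (B (T (T (B
     (T (T (V 44))) (T (T (V 29)))))) (T (B (B (T (T (V 44))) (T (T (V 29)))) (B (T (T (V 29)))
     (T (T (V 22)))))))))"

definition "pot19 =
    F (B (B (B (B (T (T (B (T (T (V 29))) (T (B (V 29) (V 26)))))) (T (B (B (T (T (V 29))) (T (B
     (V 29) (V 26)))) (B (T (T (V 30))) (T (B (V 30) (V 43))))))) (B (T (T (B (T (T (V 34))) (T
     (B (V 34) (V 23)))))) (T (B (B (T (T (V 34))) (T (B (V 34) (V 23)))) (B (T (T (V 27))) (T (F
     (V 27)))))))) (B (B (T (T (B (T (T (V 42))) (T (B (V 42) (V 23)))))) (T (B (B (T (T (V 42)))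
     (T (B (V 42) (V 23)))) (B (T (T (V 23))) (T (B (V 23) (V 20))))))) (B (T (T (B (T (T (V
     39))) (T (B (V 39) (V 20)))))) (T (B (B (T (T (V 39))) (T (B (V 39) (V 20)))) (B (T (T (V
     32))) (T (B (V 32) (V 37))))))))) (B (B (B (T (T (B (T (T (V 42))) (T (B (V 42) (V 35))))))
     (T (B (B (T (T (V 42))) (T (B (V 42) (V 35)))) (B (T (T (V 31))) (T (B (V 31) (V 36)))))))
     (B (T (T (B (T (T (V 39))) (T (B (V 39) (V 28)))))) (T (B (B (T (T (V 39))) (T (B (V 39) (V
     28)))) (B (T (T (V 24))) (T (F (V 24)))))))) (T (B (T (T (B (T (T (V 52))) (T (B (V 52) (V
     29)))))) (T (B (B (T (T (V 52))) (T (B (V 52) (V 29)))) (B (T (T (V 33))) (T (B (V 33) (V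
     18))))))))))"

definition "pot20 =
    B (B (B (B (B (B (T (T (T (T (B (V 37) (V 18)))))) (T (B (T (T (B (V 37) (V 18)))) (T (B (B
     (V 37) (V 18)) (B (V 26) (V 35))))))) (B (T (T (T (T (B (V 34) (V 27)))))) (T (B (T (T (B (V
     34) (V 27)))) (T (B (B (V 34) (V 27)) (F (V 31)))))))) (B (B (T (T (T (T (B (V 42) (V
     23)))))) (T (B (T (T (B (V 42) (V 23)))) (T (B (B (V 42) (V 23)) (B (V 31) (V 24))))))) (B
     (T (T (T (T (B (V 39) (V 24)))))) (T (B (T (T (B (V 39) (V 24)))) (T (B (B (V 39) (V 24)) (B
     (V 16) (V 29))))))))) (B (B (B (T (T (T (T (B (V 46) (V 31)))))) (T (B (T (T (B (V 46) (V
     31)))) (T (B (B (V 46) (V 31)) (B (V 35) (V 24))))))) (B (T (T (T (T (B (V 39) (V 16))))))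
     (T (B (T (T (B (V 39) (V 16)))) (T (B (B (V 39) (V 16)) (F (V 24)))))))) (T (B (T (T (T (T
     (B (V 44) (V 33)))))) (T (B (T (T (B (V 44) (V 33)))) (T (B (B (V 44) (V 33)) (B (V 29) (V
     30)))))))))) (B (B (B (T (T (T (T (T (T (V 20))))))) (T (T (T (T (T (T (V 25)))))))) (B (T
     (T (T (T (T (T (V 25))))))) (T (T (T (T (T (T (V 22))))))))) (B (B (T (T (T (T (T (T (V
     29))))))) (T (T (T (T (T (T (V 22)))))))) (T (T (T (T (T (T (T (V 27))))))))))) (F (B (B (B
     (T (T (T (T (T (T (V 20))))))) (T (T (T (T (T (T (V 17)))))))) (B (T (T (T (T (T (T (V
     25))))))) (T (T (T (T (T (T (V 26))))))))) (B (B (T (T (T (T (T (T (V 29))))))) (T (T (T (T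
     (T (T (V 22)))))))) (T (T (T (T (T (T (T (V 35)))))))))))"

definition "pot21 =
    F (B (B (B (B (B (T (T (T (T (B (B (V 29) (V 22)) (F (V 22))))))) (T (T (T (T (B (B (V 22)
     (V 31)) (F (V 23)))))))) (B (T (T (T (T (B (B (V 38) (V 31)) (F (V 19))))))) (T (T (T (T (B
     (B (V 19) (V 32)) (F (V 16))))))))) (B (B (T (T (T (T (B (B (V 42) (V 35)) (F (V 19)))))))
     (T (T (T (T (B (B (V 11) (V 32)) (F (V 24)))))))) (T (T (T (T (T (B (B (V 40) (V 33)) (F (V
     29)))))))))) (B (B (B (T (T (T (T (T (T (V 16))))))) (T (T (T (T (T (T (V 29)))))))) (B (T
     (T (T (T (T (T (V 25))))))) (T (T (T (T (T (T (V 22))))))))) (B (B (T (T (T (T (T (T (V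
     25))))))) (T (T (T (T (T (T (V 22)))))))) (T (T (T (T (T (T (T (V 35))))))))))) (F (B (B (B
     (T (T (T (T (T (T (V 16))))))) (T (T (T (T (T (T (V 21)))))))) (B (T (T (T (T (T (T (V
     25))))))) (T (T (T (T (T (T (V 22))))))))) (B (B (T (T (T (T (T (T (V 25))))))) (T (T (T (T
     (T (T (V 22)))))))) (T (T (T (T (T (T (T (V 35))))))))))))"

definition "pot22 =
    B (B (T (T (B (B (B (B (V 26) (V 31)) (F (V 19))) (B (B (V 19) (V 24)) (B (V 20) (V 25))))
     (B (B (B (V 19) (V 24)) (F (V 24))) (B (F (V 20)) (B (V 37) (V 22))))))) (T (B (B (B (B (B
     (V 26) (V 31)) (F (V 19))) (B (B (V 19) (V 24)) (B (V 20) (V 25)))) (B (B (B (V 19) (V 24))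
     (F (V 24))) (B (F (V 20)) (B (V 37) (V 22))))) (B (B (B (B (V 23) (V 28)) (F (V 20))) (B (B
     (V 20) (V 13)) (B (V 13) (V 30)))) (B (B (B (V 20) (V 17)) (F (V 21))) (B (B (V 13) (V 22))
     (B (V 14) (V 23)))))))) (B (T (T (B (B (B (B (V 23) (V 32)) (F (V 32))) (B (B (V 20) (V 21))
     (B (V 21) (V 26)))) (B (B (B (V 32) (V 21)) (F (V 25))) (B (F (V 17)) (B (V 50) (V 23)))))))
     (T (B (B (B (B (B (V 23) (V 32)) (F (V 32))) (B (B (V 20) (V 21)) (B (V 21) (V 26)))) (B (B
     (B (V 32) (V 21)) (F (V 25))) (B (F (V 17)) (B (V 50) (V 23))))) (B (B (B (B (V 28) (V 21))
     (F (V 25))) (B (F (V 17)) (T (V 23)))) (T (B (B (V 14) (V 27)) (B (V 23) (V 28))))))))"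

definition "pot23 =
    B (B (T (T (B (B (B (B (V 27) (V 28)) (F (V 24))) (B (B (V 20) (V 21)) (B (V 33) (V 26))))
     (B (B (B (V 24) (V 21)) (F (V 13))) (B (F (V 17)) (B (V 42) (V 31))))))) (T (B (B (B (B (B
     (V 27) (V 28)) (F (V 24))) (B (B (V 20) (V 21)) (B (V 33) (V 26)))) (B (B (B (V 24) (V 21))
     (F (V 13))) (B (F (V 17)) (B (V 42) (V 31))))) (B (B (B (B (V 28) (V 5)) (F (V 21))) (B (F
     (V 21)) (T (V 23)))) (T (B (B (V 22) (V 31)) (B (V 27) (V 28)))))))) (T (T (T (B (B (B (B (V
     33) (V 22)) (F (V 22))) (B (B (V 18) (V 23)) (B (V 27) (V 20)))) (B (B (B (V 22) (V 31)) (F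
     (V 23))) (B (F (V 23)) (B (V 44) (V 21))))))))"

definition "pot24 =
    B (B (B (T (T (B (B (T (T (V 25))) (T (T (V 14)))) (B (T (T (V 22))) (T (T (V 39))))))) (T
     (B (B (B (T (T (V 25))) (T (T (V 14)))) (B (T (T (V 22))) (T (T (V 39))))) (B (B (T (T (V
     26))) (T (T (V 23)))) (B (T (T (V 23))) (T (T (V 20)))))))) (B (T (T (B (B (T (T (V 22))) (T
     (T (V 23)))) (B (T (T (V 19))) (T (T (V 36))))))) (T (B (B (B (T (T (V 22))) (T (T (V 23))))
     (B (T (T (V 19))) (T (T (V 36))))) (B (B (T (T (V 15))) (T (T (V 36)))) (T (T (T (V
     29))))))))) (B (B (T (T (B (B (T (T (V 22))) (T (T (V 27)))) (B (T (T (V 31))) (T (T (V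
     32))))))) (T (B (B (B (T (T (V 22))) (T (T (V 27)))) (B (T (T (V 31))) (T (T (V 32))))) (B
     (B (T (T (V 15))) (T (T (V 32)))) (T (T (T (V 33)))))))) (T (T (T (B (B (T (T (V 20))) (T (T
     (V 25)))) (B (T (T (V 25))) (T (T (V 34)))))))))"

definition "pot25 =
    F (B (B (B (T (T (B (B (T (T (V 25))) (T (B (V 25) (V 30)))) (B (T (T (V 22))) (T (F (V
     22))))))) (T (B (B (B (T (T (V 25))) (T (B (V 25) (V 30)))) (B (T (T (V 22))) (T (F (V
     22))))) (B (B (T (T (V 30))) (T (B (V 30) (V 23)))) (B (T (T (V 23))) (T (B (V 23) (V
     20)))))))) (B (T (T (B (B (T (T (V 26))) (T (B (V 26) (V 23)))) (B (T (T (V 23))) (T (F (V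
     23))))))) (T (B (B (B (T (T (V 26))) (T (B (V 26) (V 23)))) (B (T (T (V 23))) (T (F (V
     23))))) (B (B (T (T (V 23))) (T (F (V 23)))) (T (T (T (V 25))))))))) (B (B (T (T (B (B (T (T
     (V 26))) (T (B (V 26) (V 27)))) (B (T (T (V 31))) (T (F (V 31))))))) (T (B (B (B (T (T (V
     26))) (T (B (V 26) (V 27)))) (B (T (T (V 31))) (T (F (V 31))))) (B (B (T (T (V 23))) (T (F
     (V 23)))) (T (T (T (V 33)))))))) (T (T (T (B (B (T (T (V 20))) (T (B (V 20) (V 33)))) (B (T
     (T (V 21))) (T (F (V 21))))))))))"

definition "pot26 =
    B (B (B (B (B (T (T (B (T (T (B (V 37) (V 22)))) (T (B (B (V 37) (V 22)) (B (V 26) (V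
     31))))))) (T (B (B (T (T (B (V 37) (V 22)))) (T (B (B (V 37) (V 22)) (B (V 26) (V 31))))) (B
     (T (T (B (V 34) (V 27)))) (T (B (B (V 34) (V 27)) (B (V 31) (V 36)))))))) (B (T (T (B (T (T
     (B (V 50) (V 27)))) (T (B (B (V 50) (V 27)) (B (V 31) (V 32))))))) (T (B (B (T (T (B (V 50)
     (V 27)))) (T (B (B (V 50) (V 27)) (B (V 31) (V 32))))) (B (T (T (B (V 39) (V 28)))) (T (B (B
     (V 39) (V 28)) (F (V 28))))))))) (B (B (T (T (B (T (T (B (V 42) (V 31)))) (T (B (B (V 42) (V
     31)) (B (V 35) (V 28))))))) (T (B (B (T (T (B (V 42) (V 31)))) (T (B (B (V 42) (V 31)) (B (V
     35) (V 28))))) (B (T (T (B (V 35) (V 28)))) (T (B (B (V 35) (V 28)) (F (V 28)))))))) (T (T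
     (T (B (T (T (B (V 44) (V 21)))) (T (B (B (V 44) (V 21)) (B (V 33) (V 22)))))))))) (B (B (B
     (T (T (T (T (T (T (V 20))))))) (T (B (T (T (T (T (V 20))))) (T (T (T (T (V 25)))))))) (B (T
     (T (T (T (T (T (V 33))))))) (T (B (T (T (T (T (V 33))))) (T (T (T (T (V 22))))))))) (B (B (T
     (T (T (T (T (T (V 25))))))) (T (B (T (T (T (T (V 25))))) (T (T (T (T (V 18)))))))) (T (T (T
     (T (T (T (T (V 27))))))))))) (F (B (B (B (T (T (T (T (T (T (V 20))))))) (T (B (T (T (T (T (V
     20))))) (T (T (T (T (V 17)))))))) (B (T (T (T (T (T (T (V 33))))))) (T (B (T (T (T (T (V
     33))))) (T (T (T (T (V 34))))))))) (B (B (T (T (T (T (T (T (V 33))))))) (T (B (T (T (T (T (V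
     33))))) (T (T (T (T (V 18)))))))) (T (T (T (T (T (T (T (V 27)))))))))))"

definition "pot27 =
    B (B (B (B (B (B (T (T (T (T (B (B (V 17) (V 22)) (F (V 14))))))) (T (B (T (T (B (B (V 17)
     (V 22)) (F (V 14))))) (T (B (B (B (V 17) (V 22)) (F (V 14))) (B (B (V 30) (V 27)) (B (V 23)
     (V 20)))))))) (B (T (T (T (T (B (B (V 14) (V 27)) (F (V 23))))))) (T (B (T (T (B (B (V 14)
     (V 27)) (F (V 23))))) (T (B (B (B (V 14) (V 27)) (F (V 23))) (B (F (V 23)) (T (V 25)))))))))
     (B (B (T (T (T (T (B (B (V 22) (V 31)) (F (V 27))))))) (T (B (T (T (B (B (V 22) (V 31)) (F
     (V 27))))) (T (B (B (B (V 22) (V 31)) (F (V 27))) (B (F (V 27)) (T (V 33)))))))) (T (T (T (T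
     (T (B (B (V 20) (V 33)) (F (V 25)))))))))) (B (B (B (T (T (T (T (T (T (V 20))))))) (T (B (T
     (T (T (T (V 20))))) (T (B (T (T (V 20))) (T (T (V 33)))))))) (B (T (T (T (T (T (T (V
     29))))))) (T (B (T (T (T (T (V 29))))) (T (B (T (T (V 29))) (T (T (V 38))))))))) (B (B (T (T
     (T (T (T (T (V 33))))))) (T (B (T (T (T (T (V 33))))) (T (B (T (T (V 33))) (T (T (V
     38)))))))) (T (T (T (T (T (T (T (V 27))))))))))) (F (B (B (B (T (T (T (T (T (T (V 20)))))))
     (T (B (T (T (T (T (V 20))))) (T (B (T (T (V 20))) (T (B (V 20) (V 33)))))))) (B (T (T (T (T
     (T (T (V 25))))))) (T (B (T (T (T (T (V 25))))) (T (B (T (T (V 25))) (T (F (V 25))))))))) (B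
     (B (T (T (T (T (T (T (V 33))))))) (T (B (T (T (T (T (V 33))))) (T (B (T (T (V 33))) (T (F (V
     33)))))))) (T (T (T (T (T (T (T (V 27)))))))))))) (F (F (B (B (T (T (T (T (T (T (B (V 28) (V
     17)))))))) (T (T (T (T (T (T (B (V 33) (V 18))))))))) (F (T (T (T (T (T (T (B (V 37) (V
     14))))))))))))"

definition "pot28 =
    F (B (B (B (B (B (T (T (T (T (B (B (B (V 29) (V 42)) (F (V 38))) (B (B (V 22) (V 11)) (B (V
     19) (V 40)))))))) (T (T (T (T (B (B (B (V 22) (V 19)) (F (V 19))) (B (B (V 23) (V 24)) (B (V
     16) (V 29))))))))) (F (T (T (T (T (B (B (B (V 22) (V 35)) (F (V 31))) (B (B (V 31) (V 32))
     (B (V 32) (V 33)))))))))) (B (B (T (T (T (T (B (T (T (V 28))) (T (T (V 29)))))))) (T (T (T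
     (T (B (T (T (V 29))) (T (T (V 6))))))))) (F (T (T (T (T (B (T (T (V 33))) (T (T (V
     22))))))))))) (F (B (B (T (T (T (T (B (T (T (V 40))) (T (B (V 40) (V 29)))))))) (T (T (T (T
     (B (T (T (V 29))) (T (B (V 29) (V 26))))))))) (F (T (T (T (T (B (T (T (V 33))) (T (B (V 33)
     (V 26)))))))))))) (F (F (B (B (T (T (T (T (T (T (B (V 44) (V 25)))))))) (T (T (T (T (T (T (B
     (V 33) (V 22))))))))) (F (T (T (T (T (T (T (B (V 37) (V 18)))))))))))))"

definition "pot29 =
    B (T (T (B (B (B (B (B (V 34) (V 35)) (F (V 39))) (B (B (V 27) (V 40)) (B (V 40) (V 29))))
     (B (B (B (V 39) (V 40)) (F (V 40))) (B (F (V 40)) (B (V 61) (V 34))))) (B (B (B (B (V 39) (V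
     48)) (F (V 36))) (B (B (V 40) (V 41)) (B (V 41) (V 38)))) (B (B (B (V 52) (V 41)) (F (V
     41))) (B (B (V 37) (V 42)) (B (V 38) (V 31)))))))) (T (B (B (B (B (B (B (V 34) (V 35)) (F (V
     39))) (B (B (V 27) (V 40)) (B (V 40) (V 29)))) (B (B (B (V 39) (V 40)) (F (V 40))) (B (F (V
     40)) (B (V 61) (V 34))))) (B (B (B (B (V 39) (V 48)) (F (V 36))) (B (B (V 40) (V 41)) (B (V
     41) (V 38)))) (B (B (B (V 52) (V 41)) (F (V 41))) (B (B (V 37) (V 42)) (B (V 38) (V 31))))))
     (B (B (B (B (B (V 31) (V 28)) (F (V 20))) (B (B (V 20) (V 29)) (B (V 33) (V 30)))) (B (B (B
     (V 20) (V 25)) (F (V 21))) (B (F (V 13)) (B (V 46) (V 31))))) (B (B (B (B (V 28) (V 25)) (F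
     (V 29))) (B (B (V 29) (V 26)) (B (V 34) (V 23)))) (B (B (B (V 37) (V 34)) (F (V 34))) (B (B
     (V 26) (V 35)) (B (V 31) (V 24))))))))"

definition "pot30 =
    B (T (T (B (B (B (B (B (V 27) (V 24)) (F (V 24))) (B (B (V 4) (V 17)) (B (V 17) (V 30)))) (B
     (B (B (V 24) (V 21)) (F (V 21))) (B (F (V 13)) (B (V 38) (V 27))))) (B (B (B (B (V 24) (V
     21)) (F (V 21))) (B (B (V 17) (V 34)) (B (V 34) (V 31)))) (B (B (B (V 45) (V 18)) (F (V
     26))) (B (B (V 22) (V 31)) (B (V 27) (V 24)))))))) (T (B (B (B (B (B (B (V 27) (V 24)) (F (V
     24))) (B (B (V 4) (V 17)) (B (V 17) (V 30)))) (B (B (B (V 24) (V 21)) (F (V 21))) (B (F (V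
     13)) (B (V 38) (V 27))))) (B (B (B (B (V 24) (V 21)) (F (V 21))) (B (B (V 17) (V 34)) (B (V
     34) (V 31)))) (B (B (B (V 45) (V 18)) (F (V 26))) (B (B (V 22) (V 31)) (B (V 27) (V 24))))))
     (B (B (B (B (B (V 28) (V 37)) (F (V 25))) (B (B (V 25) (V 30)) (B (V 30) (V 35)))) (B (B (B
     (V 45) (V 18)) (F (V 26))) (T (B (V 35) (V 24))))) (T (B (B (B (V 18) (V 31)) (F (V 23))) (B
     (B (V 27) (V 16)) (B (V 24) (V 33))))))))"

definition "pot31 =
    B (B (T (T (B (B (B (T (T (V 37))) (T (T (V 50)))) (B (T (T (V 34))) (T (T (V 47))))) (B (B
     (T (T (V 42))) (T (T (V 39)))) (B (T (T (V 35))) (T (T (V 48)))))))) (T (B (B (B (B (T (T (V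
     37))) (T (T (V 50)))) (B (T (T (V 34))) (T (T (V 47))))) (B (B (T (T (V 42))) (T (T (V
     39)))) (B (T (T (V 35))) (T (T (V 48)))))) (B (B (B (T (T (V 22))) (T (T (V 31)))) (B (T (T
     (V 31))) (T (T (V 20))))) (B (B (T (T (V 31))) (T (T (V 28)))) (B (T (T (V 28))) (T (T (V
     33))))))))) (B (T (T (B (B (B (T (T (V 18))) (T (T (V 27)))) (B (T (T (V 19))) (T (T (V
     36))))) (B (B (T (T (V 19))) (T (T (V 28)))) (B (T (T (V 28))) (T (T (V 37)))))))) (T (B (B
     (B (B (T (T (V 18))) (T (T (V 27)))) (B (T (T (V 19))) (T (T (V 36))))) (B (B (T (T (V 19)))
     (T (T (V 28)))) (B (T (T (V 28))) (T (T (V 37)))))) (B (B (B (T (T (V 35))) (T (T (V 32))))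
     (F (T (T (V 28))))) (T (B (T (T (V 29))) (T (T (V 22)))))))))"

definition "pot32 =
    F (B (B (T (T (B (B (B (T (T (V 29))) (T (B (V 29) (V 34)))) (B (T (T (V 34))) (T (F (V
     34))))) (B (B (T (T (V 38))) (T (B (V 38) (V 39)))) (B (T (T (V 47))) (T (B (V 47) (V
     44)))))))) (T (B (B (B (B (T (T (V 29))) (T (B (V 29) (V 34)))) (B (T (T (V 34))) (T (F (V
     34))))) (B (B (T (T (V 38))) (T (B (V 38) (V 39)))) (B (T (T (V 47))) (T (B (V 47) (V
     44)))))) (B (B (B (T (T (V 30))) (T (B (V 30) (V 31)))) (B (T (T (V 31))) (T (F (V 31)))))
     (B (B (T (T (V 23))) (T (B (V 23) (V 32)))) (B (T (T (V 32))) (T (B (V 32) (V 33))))))))) (B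
     (T (T (B (B (B (T (T (V 30))) (T (B (V 30) (V 27)))) (B (T (T (V 27))) (T (F (V 27))))) (B
     (B (T (T (V 31))) (T (B (V 31) (V 28)))) (B (T (T (V 32))) (T (B (V 32) (V 21)))))))) (T (B
     (B (B (B (T (T (V 30))) (T (B (V 30) (V 27)))) (B (T (T (V 27))) (T (F (V 27))))) (B (B (T
     (T (V 31))) (T (B (V 31) (V 28)))) (B (T (T (V 32))) (T (B (V 32) (V 21)))))) (B (B (B (T (T
     (V 35))) (T (B (V 35) (V 36)))) (B (T (T (V 32))) (T (F (V 32))))) (T (B (T (T (V 33))) (T
     (B (V 33) (V 18))))))))))"

definition "pot33 =
    B (B (B (B (T (T (B (B (T (T (B (V 61) (V 38)))) (T (B (B (V 61) (V 38)) (B (V 46) (V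
     35))))) (B (T (T (B (V 38) (V 31)))) (T (B (B (V 38) (V 31)) (F (V 39)))))))) (T (B (B (B (T
     (T (B (V 61) (V 38)))) (T (B (B (V 61) (V 38)) (B (V 46) (V 35))))) (B (T (T (B (V 38) (V
     31)))) (T (B (B (V 38) (V 31)) (F (V 39)))))) (B (B (T (T (B (V 46) (V 35)))) (T (B (B (V
     46) (V 35)) (B (V 39) (V 28))))) (B (T (T (B (V 39) (V 24)))) (T (B (B (V 39) (V 24)) (B (V
     28) (V 29))))))))) (B (T (T (B (B (T (T (B (V 38) (V 31)))) (T (B (B (V 38) (V 31)) (B (V
     35) (V 24))))) (B (T (T (B (V 31) (V 24)))) (T (B (B (V 31) (V 24)) (F (V 24)))))))) (T (B
     (B (B (T (T (B (V 38) (V 31)))) (T (B (B (V 38) (V 31)) (B (V 35) (V 24))))) (B (T (T (B (V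
     31) (V 24)))) (T (B (B (V 31) (V 24)) (F (V 24)))))) (B (B (T (T (B (V 35) (V 24)))) (T (B
     (B (V 35) (V 24)) (F (V 28))))) (T (T (T (B (V 29) (V 30)))))))))) (B (B (T (T (B (T (T (T
     (T (V 44))))) (T (T (T (T (V 37)))))))) (T (B (B (T (T (T (T (V 44))))) (T (T (T (T (V
     37)))))) (B (T (T (T (T (V 29))))) (T (T (T (T (V 22))))))))) (B (T (T (B (T (T (T (T (V
     29))))) (T (T (T (T (V 14)))))))) (T (B (B (T (T (T (T (V 29))))) (T (T (T (T (V 14)))))) (F
     (T (T (T (T (V 18))))))))))) (F (B (B (T (T (B (T (T (T (T (V 44))))) (T (T (T (T (V
     21)))))))) (T (B (B (T (T (T (T (V 44))))) (T (T (T (T (V 21)))))) (B (T (T (T (T (V 37)))))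
     (T (T (T (T (V 22))))))))) (B (T (T (B (T (T (T (T (V 21))))) (T (T (T (T (V 14)))))))) (T
     (B (B (T (T (T (T (V 21))))) (T (T (T (T (V 14)))))) (F (T (T (T (T (V 18)))))))))))"

definition "pot34 =
    B (B (B (B (B (T (T (B (T (T (B (B (V 37) (V 42)) (F (V 50))))) (T (B (B (B (V 37) (V 42))
     (F (V 50))) (B (B (V 34) (V 35)) (B (V 39) (V 44)))))))) (T (B (B (T (T (B (B (V 37) (V 42))
     (F (V 50))))) (T (B (B (B (V 37) (V 42)) (F (V 50))) (B (B (V 34) (V 35)) (B (V 39) (V
     44)))))) (B (T (T (B (B (V 26) (V 35)) (F (V 31))))) (T (B (B (B (V 26) (V 35)) (F (V 31)))
     (B (B (V 31) (V 28)) (B (V 28) (V 33))))))))) (B (T (T (B (T (T (B (B (V 22) (V 31)) (F (V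
     27))))) (T (B (B (B (V 22) (V 31)) (F (V 27))) (B (B (V 27) (V 28)) (B (V 28) (V 21))))))))
     (T (B (B (T (T (B (B (V 22) (V 31)) (F (V 27))))) (T (B (B (B (V 22) (V 31)) (F (V 27))) (B
     (B (V 27) (V 28)) (B (V 28) (V 21)))))) (B (T (T (B (B (V 31) (V 28)) (F (V 32))))) (T (B (B
     (B (V 31) (V 28)) (F (V 32))) (B (F (V 36)) (T (V 22)))))))))) (B (B (T (T (B (T (T (T (T (V
     48))))) (T (B (T (T (V 48))) (T (T (V 45)))))))) (T (B (B (T (T (T (T (V 48))))) (T (B (T (T
     (V 48))) (T (T (V 45)))))) (B (T (T (T (T (V 33))))) (T (B (T (T (V 33))) (T (T (V
     38))))))))) (B (T (T (B (T (T (T (T (V 37))))) (T (B (T (T (V 37))) (T (T (V 34)))))))) (T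
     (B (B (T (T (T (T (V 37))))) (T (B (T (T (V 37))) (T (T (V 34)))))) (B (T (T (T (T (V
     26))))) (T (B (T (T (V 26))) (T (T (V 47))))))))))) (F (B (B (T (T (B (T (T (T (T (V 44)))))
     (T (B (T (T (V 44))) (T (B (V 44) (V 37)))))))) (T (B (B (T (T (T (T (V 44))))) (T (B (T (T
     (V 44))) (T (B (V 44) (V 37)))))) (B (T (T (T (T (V 33))))) (T (B (T (T (V 33))) (T (B (V
     33) (V 38))))))))) (B (T (T (B (T (T (T (T (V 21))))) (T (B (T (T (V 21))) (T (B (V 21) (V
     38)))))))) (T (B (B (T (T (T (T (V 21))))) (T (B (T (T (V 21))) (T (B (V 21) (V 38)))))) (B
     (T (T (T (T (V 22))))) (T (B (T (T (V 22))) (T (F (V 22)))))))))))) (F (F (B (B (T (T (T (T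
     (T (T (B (V 44) (V 37)))))))) (T (B (T (T (T (T (B (V 44) (V 37)))))) (T (T (T (T (B (V 37)
     (V 30))))))))) (B (T (T (T (T (T (T (B (V 21) (V 14)))))))) (T (B (T (T (T (T (B (V 21) (V
     14)))))) (T (T (T (T (B (V 42) (V 19))))))))))))"

definition "pot35 =
    B (B (B (B (B (T (T (T (T (B (B (B (V 37) (V 46)) (F (V 42))) (B (B (V 34) (V 39)) (B (V 39)
     (V 44)))))))) (T (B (T (T (B (B (B (V 37) (V 46)) (F (V 42))) (B (B (V 34) (V 39)) (B (V 39)
     (V 44)))))) (T (B (B (B (B (V 37) (V 46)) (F (V 42))) (B (B (V 34) (V 39)) (B (V 39) (V
     44)))) (B (B (B (V 26) (V 35)) (F (V 31))) (B (B (V 31) (V 24)) (B (V 16) (V 29))))))))) (B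
     (T (T (T (T (B (B (B (V 18) (V 31)) (F (V 23))) (B (B (V 27) (V 16)) (B (V 24) (V 33))))))))
     (T (B (T (T (B (B (B (V 18) (V 31)) (F (V 23))) (B (B (V 27) (V 16)) (B (V 24) (V 33))))))
     (T (B (B (B (B (V 18) (V 31)) (F (V 23))) (B (B (V 27) (V 16)) (B (V 24) (V 33)))) (B (B (B
     (V 35) (V 24)) (F (V 24))) (T (B (V 29) (V 30)))))))))) (B (B (T (T (T (T (B (T (T (V 52)))
     (T (T (V 33)))))))) (T (B (T (T (B (T (T (V 52))) (T (T (V 33)))))) (T (B (B (T (T (V 52)))
     (T (T (V 33)))) (B (T (T (V 29))) (T (T (V 22))))))))) (B (T (T (T (T (B (T (T (V 29))) (T
     (T (V 22)))))))) (T (B (T (T (B (T (T (V 29))) (T (T (V 22)))))) (T (B (B (T (T (V 29))) (T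
     (T (V 22)))) (F (T (T (V 18))))))))))) (F (B (B (T (T (T (T (B (T (T (V 44))) (T (B (V 44)
     (V 37)))))))) (T (B (T (T (B (T (T (V 44))) (T (B (V 44) (V 37)))))) (T (B (B (T (T (V 44)))
     (T (B (V 44) (V 37)))) (B (T (T (V 29))) (T (B (V 29) (V 26))))))))) (B (T (T (T (T (B (T (T
     (V 33))) (T (B (V 33) (V 18)))))))) (T (B (T (T (B (T (T (V 33))) (T (B (V 33) (V 18))))))
     (T (B (B (T (T (V 33))) (T (B (V 33) (V 18)))) (B (T (T (V 30))) (T (F (V 30)))))))))))) (B
     (B (B (B (T (T (T (T (T (T (B (V 52) (V 29)))))))) (T (B (T (T (T (T (B (V 52) (V 29))))))
     (T (B (T (T (B (V 52) (V 29)))) (T (B (B (V 52) (V 29)) (B (V 37) (V 22))))))))) (B (T (T (T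
     (T (T (T (B (V 29) (V 30)))))))) (T (B (T (T (T (T (B (V 29) (V 30)))))) (T (B (T (T (B (V
     29) (V 30)))) (T (B (B (V 29) (V 30)) (F (V 22)))))))))) (B (T (T (T (T (T (T (T (T (V
     35))))))))) (T (T (T (T (T (T (T (T (V 12))))))))))) (F (B (T (T (T (T (T (T (T (T (V
     35))))))))) (T (T (T (T (T (T (T (T (V 20))))))))))))"

definition "pot36 =
    F (B (B (B (T (T (T (T (T (T (B (B (V 44) (V 37)) (F (V 33))))))))) (T (T (T (T (T (T (B (B
     (V 25) (V 18)) (F (V 22)))))))))) (B (T (T (T (T (T (T (T (T (V 35))))))))) (T (T (T (T (T
     (T (T (T (V 28))))))))))) (F (B (T (T (T (T (T (T (T (T (V 27))))))))) (T (T (T (T (T (T (T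
     (T (V 20))))))))))))"

definition "pot37 =
    F (B (B (B (B (B (T (T (T (T (B (B (B (B (V 37) (V 38)) (F (V 38))) (B (B (V 38) (V 35)) (B
     (V 39) (V 40)))) (B (B (B (V 38) (V 31)) (F (V 35))) (B (F (V 35)) (B (V 44) (V 21)))))))))
     (T (T (T (T (B (B (B (B (V 18) (V 19)) (F (V 19))) (B (B (V 19) (V 24)) (B (V 28) (V 21))))
     (B (B (B (V 19) (V 24)) (F (V 24))) (B (F (V 20)) (B (V 37) (V 14)))))))))) (B (T (T (T (T
     (B (B (T (T (V 44))) (T (T (V 33)))) (B (T (T (V 37))) (T (T (V 54))))))))) (T (T (T (T (B
     (B (T (T (V 21))) (T (T (V 18)))) (B (T (T (V 14))) (T (T (V 43))))))))))) (F (B (T (T (T (T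
     (B (B (T (T (V 40))) (T (B (V 40) (V 37)))) (B (T (T (V 21))) (T (F (V 21))))))))) (T (T (T
     (T (B (B (T (T (V 21))) (T (B (V 21) (V 18)))) (B (T (T (V 14))) (T (F (V 14)))))))))))) (B
     (B (B (T (T (T (T (B (T (T (B (V 44) (V 21)))) (T (B (B (V 44) (V 21)) (B (V 37) (V
     42))))))))) (T (T (T (T (B (T (T (B (V 37) (V 14)))) (T (B (B (V 37) (V 14)) (B (V 30) (V
     19)))))))))) (B (T (T (T (T (T (T (T (T (V 27))))))))) (T (T (T (T (T (T (T (T (V
     20))))))))))) (F (B (T (T (T (T (T (T (T (T (V 27))))))))) (T (T (T (T (T (T (T (T (V
     20))))))))))))) (F (B (B (B (T (T (T (T (T (T (B (B (V 28) (V 37)) (F (V 33))))))))) (T (T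
     (T (T (T (T (B (B (V 17) (V 14)) (F (V 18)))))))))) (B (T (T (T (T (T (T (T (T (V
     31))))))))) (T (T (T (T (T (T (T (T (V 24))))))))))) (F (B (T (T (T (T (T (T (T (T (V
     35))))))))) (T (T (T (T (T (T (T (T (V 20))))))))))))))"

definition "pot38 =
    T (T (B (B (B (B (B (B (V 30) (V 23)) (F (V 23))) (B (B (V 15) (V 24)) (B (V 32) (V 29))))
     (B (B (B (V 39) (V 32)) (F (V 32))) (B (F (V 36)) (B (V 29) (V 30))))) (B (B (B (B (V 15) (V
     20)) (F (V 12))) (B (B (V 16) (V 21)) (B (V 21) (V 18)))) (B (B (B (V 40) (V 21)) (F (V
     21))) (B (B (V 25) (V 26)) (B (V 26) (V 27)))))) (B (B (B (B (B (V 23) (V 32)) (F (V 32)))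
     (B (B (V 4) (V 17)) (B (V 17) (V 30)))) (B (B (B (V 32) (V 21)) (F (V 21))) (B (F (V 13)) (B
     (V 34) (V 27))))) (B (B (B (B (V 32) (V 21)) (F (V 21))) (B (F (V 17)) (T (V 27)))) (B (B (B
     (V 29) (V 42)) (F (V 42))) (B (B (V 22) (V 31)) (B (V 23) (V 32))))))))"

definition "pot39 =
    T (B (B (B (B (B (B (B (V 30) (V 23)) (F (V 23))) (B (B (V 15) (V 24)) (B (V 32) (V 29))))
     (B (B (B (V 39) (V 32)) (F (V 32))) (B (F (V 36)) (B (V 29) (V 30))))) (B (B (B (B (V 15) (V
     20)) (F (V 12))) (B (B (V 16) (V 21)) (B (V 21) (V 18)))) (B (B (B (V 40) (V 21)) (F (V
     21))) (B (B (V 25) (V 26)) (B (V 26) (V 27)))))) (B (B (B (B (B (V 23) (V 32)) (F (V 32)))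
     (B (B (V 4) (V 17)) (B (V 17) (V 30)))) (B (B (B (V 32) (V 21)) (F (V 21))) (B (F (V 13)) (B
     (V 34) (V 27))))) (B (B (B (B (V 32) (V 21)) (F (V 21))) (B (F (V 17)) (T (V 27)))) (B (B (B
     (V 29) (V 42)) (F (V 42))) (B (B (V 22) (V 31)) (B (V 23) (V 32))))))) (B (B (B (B (B (B (V
     23) (V 36)) (F (V 20))) (B (B (V 20) (V 13)) (B (V 13) (V 30)))) (B (B (B (V 20) (V 17)) (F
     (V 21))) (B (F (V 13)) (B (V 34) (V 23))))) (B (B (B (B (V 32) (V 21)) (F (V 17))) (B (F (V
     29)) (T (V 15)))) (T (B (B (V 30) (V 27)) (B (V 23) (V 28)))))) (T (B (B (B (B (V 33) (V
     22)) (F (V 22))) (B (B (V 18) (V 23)) (B (V 27) (V 20)))) (B (B (B (V 22) (V 31)) (F (V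
     23))) (B (B (V 23) (V 28)) (B (V 20) (V 21))))))))"

definition "pot40 =
    B (T (T (B (B (B (B (T (T (V 25))) (T (T (V 26)))) (B (T (T (V 26))) (T (T (V 47))))) (B (B
     (T (T (V 18))) (T (T (V 23)))) (B (T (T (V 23))) (T (T (V 32)))))) (B (B (B (T (T (V 26)))
     (T (T (V 23)))) (B (T (T (V 23))) (T (T (V 36))))) (B (B (T (T (V 31))) (T (T (V 36)))) (B
     (T (T (V 44))) (T (T (V 29))))))))) (T (B (B (B (B (B (T (T (V 25))) (T (T (V 26)))) (B (T
     (T (V 26))) (T (T (V 47))))) (B (B (T (T (V 18))) (T (T (V 23)))) (B (T (T (V 23))) (T (T (V
     32)))))) (B (B (B (T (T (V 26))) (T (T (V 23)))) (B (T (T (V 23))) (T (T (V 36))))) (B (B (T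
     (T (V 31))) (T (T (V 36)))) (B (T (T (V 44))) (T (T (V 29))))))) (B (B (B (B (T (T (V 26)))
     (T (T (V 23)))) (B (T (T (V 23))) (T (T (V 20))))) (B (B (T (T (V 23))) (T (T (V 28)))) (T
     (T (T (V 33)))))) (T (B (B (T (T (V 20))) (T (T (V 25)))) (B (T (T (V 25))) (T (T (V
     26)))))))))"

definition "pot41 =
    F (B (T (T (B (B (B (B (T (T (V 29))) (T (B (V 29) (V 30)))) (B (T (T (V 30))) (T (F (V
     30))))) (B (B (T (T (V 18))) (T (B (V 18) (V 15)))) (B (T (T (V 27))) (T (B (V 27) (V
     20)))))) (B (B (B (T (T (V 30))) (T (B (V 30) (V 23)))) (B (T (T (V 27))) (T (F (V 27)))))
     (B (B (T (T (V 27))) (T (F (V 27)))) (B (T (T (V 52))) (T (B (V 52) (V 21))))))))) (T (B (B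
     (B (B (B (T (T (V 29))) (T (B (V 29) (V 30)))) (B (T (T (V 30))) (T (F (V 30))))) (B (B (T
     (T (V 18))) (T (B (V 18) (V 15)))) (B (T (T (V 27))) (T (B (V 27) (V 20)))))) (B (B (B (T (T
     (V 30))) (T (B (V 30) (V 23)))) (B (T (T (V 27))) (T (F (V 27))))) (B (B (T (T (V 27))) (T
     (F (V 27)))) (B (T (T (V 52))) (T (B (V 52) (V 21))))))) (B (B (B (B (T (T (V 30))) (T (B (V
     30) (V 23)))) (B (T (T (V 23))) (T (F (V 23))))) (B (B (T (T (V 15))) (T (F (V 15)))) (T (T
     (T (V 33)))))) (T (B (B (T (T (V 20))) (T (B (V 20) (V 33)))) (B (T (T (V 21))) (T (B (V 21)
     (V 30))))))))))"

definition "pot42 =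
    B (B (B (T (T (B (B (B (T (T (B (V 29) (V 30)))) (T (B (B (V 29) (V 30)) (B (V 30) (V
     35))))) (B (T (T (B (V 38) (V 31)))) (T (B (B (V 38) (V 31)) (F (V 23)))))) (B (B (T (T (B
     (V 34) (V 27)))) (T (B (B (V 34) (V 27)) (B (V 31) (V 32))))) (B (T (T (B (V 47) (V 32))))
     (T (B (B (V 47) (V 32)) (B (V 32) (V 33))))))))) (T (B (B (B (B (T (T (B (V 29) (V 30)))) (T
     (B (B (V 29) (V 30)) (B (V 30) (V 35))))) (B (T (T (B (V 38) (V 31)))) (T (B (B (V 38) (V
     31)) (F (V 23)))))) (B (B (T (T (B (V 34) (V 27)))) (T (B (B (V 34) (V 27)) (B (V 31) (V
     32))))) (B (T (T (B (V 47) (V 32)))) (T (B (B (V 47) (V 32)) (B (V 32) (V 33))))))) (B (B (B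
     (T (T (B (V 34) (V 27)))) (T (B (B (V 34) (V 27)) (B (V 31) (V 36))))) (B (T (T (B (V 39) (V
     28)))) (T (B (B (V 39) (V 28)) (F (V 32)))))) (T (B (T (T (B (V 44) (V 21)))) (T (B (B (V
     44) (V 21)) (B (V 33) (V 18)))))))))) (B (T (T (B (B (T (T (T (T (V 12))))) (T (T (T (T (V
     25)))))) (B (T (T (T (T (V 25))))) (T (T (T (T (V 30))))))))) (T (B (B (B (T (T (T (T (V
     12))))) (T (T (T (T (V 25)))))) (B (T (T (T (T (V 25))))) (T (T (T (T (V 30))))))) (B (B (T
     (T (T (T (V 25))))) (T (T (T (T (V 22)))))) (T (T (T (T (T (V 27))))))))))) (F (B (T (T (B
     (B (T (T (T (T (V 20))))) (T (T (T (T (V 21)))))) (B (T (T (T (T (V 17))))) (T (T (T (T (V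
     34))))))))) (T (B (B (B (T (T (T (T (V 20))))) (T (T (T (T (V 21)))))) (B (T (T (T (T (V
     17))))) (T (T (T (T (V 34))))))) (B (B (T (T (T (T (V 17))))) (T (T (T (T (V 30)))))) (T (T
     (T (T (T (V 27)))))))))))"

definition "pot43 =
    B (B (B (B (T (T (B (B (T (T (B (B (V 25) (V 26)) (F (V 26))))) (T (B (B (B (V 25) (V 26))
     (F (V 26))) (B (B (V 30) (V 23)) (B (V 23) (V 20)))))) (B (T (T (B (B (V 22) (V 31)) (F (V
     23))))) (T (B (B (B (V 22) (V 31)) (F (V 23))) (B (F (V 23)) (T (V 21))))))))) (T (B (B (B
     (T (T (B (B (V 25) (V 26)) (F (V 26))))) (T (B (B (B (V 25) (V 26)) (F (V 26))) (B (B (V 30)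
     (V 23)) (B (V 23) (V 20)))))) (B (T (T (B (B (V 22) (V 31)) (F (V 23))))) (T (B (B (B (V 22)
     (V 31)) (F (V 23))) (B (F (V 23)) (T (V 21))))))) (B (B (T (T (B (B (V 30) (V 27)) (F (V
     23))))) (T (B (B (B (V 30) (V 27)) (F (V 23))) (B (F (V 23)) (T (V 33)))))) (T (T (T (B (B
     (V 20) (V 33)) (F (V 25)))))))))) (B (T (T (B (B (T (T (T (T (V 32))))) (T (B (T (T (V 32)))
     (T (T (V 25)))))) (B (T (T (T (T (V 29))))) (T (B (T (T (V 29))) (T (T (V 34))))))))) (T (B
     (B (B (T (T (T (T (V 32))))) (T (B (T (T (V 32))) (T (T (V 25)))))) (B (T (T (T (T (V
     29))))) (T (B (T (T (V 29))) (T (T (V 34))))))) (B (B (T (T (T (T (V 33))))) (T (B (T (T (V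
     33))) (T (T (V 30)))))) (T (T (T (T (T (V 27))))))))))) (F (B (T (T (B (B (T (T (T (T (V
     20))))) (T (B (T (T (V 20))) (T (B (V 20) (V 29)))))) (B (T (T (T (T (V 21))))) (T (B (T (T
     (V 21))) (T (F (V 21))))))))) (T (B (B (B (T (T (T (T (V 20))))) (T (B (T (T (V 20))) (T (B
     (V 20) (V 29)))))) (B (T (T (T (T (V 21))))) (T (B (T (T (V 21))) (T (F (V 21))))))) (B (B
     (T (T (T (T (V 33))))) (T (B (T (T (V 33))) (T (F (V 33)))))) (T (T (T (T (T (V
     27)))))))))))) (F (F (B (T (T (B (T (T (T (T (B (V 40) (V 21)))))) (T (T (T (T (B (V 21) (V
     14))))))))) (T (B (B (T (T (T (T (B (V 40) (V 21)))))) (T (T (T (T (B (V 21) (V 14))))))) (F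
     (T (T (T (T (B (V 37) (V 18))))))))))))"

definition "pot44 =
    B (B (B (T (T (B (T (T (B (B (B (V 29) (V 42)) (F (V 42))) (B (B (V 34) (V 39)) (B (V 39) (V
     52)))))) (T (B (B (B (B (V 29) (V 42)) (F (V 42))) (B (B (V 34) (V 39)) (B (V 39) (V 52))))
     (B (B (B (V 30) (V 31)) (F (V 23))) (B (B (V 27) (V 24)) (B (V 32) (V 33))))))))) (T (B (B
     (T (T (B (B (B (V 29) (V 42)) (F (V 42))) (B (B (V 34) (V 39)) (B (V 39) (V 52)))))) (T (B
     (B (B (B (V 29) (V 42)) (F (V 42))) (B (B (V 34) (V 39)) (B (V 39) (V 52)))) (B (B (B (V 30)
     (V 31)) (F (V 23))) (B (B (V 27) (V 24)) (B (V 32) (V 33))))))) (B (T (T (B (B (B (V 26) (V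
     35)) (F (V 23))) (B (B (V 23) (V 28)) (B (V 20) (V 29)))))) (T (B (B (B (B (V 26) (V 35)) (F
     (V 23))) (B (B (V 23) (V 28)) (B (V 20) (V 29)))) (B (B (B (V 43) (V 36)) (F (V 20))) (T (B
     (V 37) (V 18)))))))))) (B (T (T (B (T (T (B (T (T (V 44))) (T (T (V 29)))))) (T (B (B (T (T
     (V 44))) (T (T (V 29)))) (B (T (T (V 29))) (T (T (V 26))))))))) (T (B (B (T (T (B (T (T (V
     44))) (T (T (V 29)))))) (T (B (B (T (T (V 44))) (T (T (V 29)))) (B (T (T (V 29))) (T (T (V
     26))))))) (B (T (T (B (T (T (V 29))) (T (T (V 26)))))) (T (B (B (T (T (V 29))) (T (T (V
     26)))) (F (T (T (V 26))))))))))) (F (B (T (T (B (T (T (B (T (T (V 52))) (T (B (V 52) (V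
     29)))))) (T (B (B (T (T (V 52))) (T (B (V 52) (V 29)))) (B (T (T (V 33))) (T (B (V 33) (V
     30))))))))) (T (B (B (T (T (B (T (T (V 52))) (T (B (V 52) (V 29)))))) (T (B (B (T (T (V
     52))) (T (B (V 52) (V 29)))) (B (T (T (V 33))) (T (B (V 33) (V 30))))))) (B (T (T (B (T (T
     (V 29))) (T (B (V 29) (V 30)))))) (T (B (B (T (T (V 29))) (T (B (V 29) (V 30)))) (B (T (T (V
     30))) (T (F (V 30)))))))))))"

definition "pot45 =
    B (B (B (T (T (B (T (T (T (T (B (V 44) (V 33)))))) (T (B (T (T (B (V 44) (V 33)))) (T (B (B
     (V 44) (V 33)) (B (V 29) (V 30))))))))) (T (B (B (T (T (T (T (B (V 44) (V 33)))))) (T (B (T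
     (T (B (V 44) (V 33)))) (T (B (B (V 44) (V 33)) (B (V 29) (V 30))))))) (B (T (T (T (T (B (V
     37) (V 18)))))) (T (B (T (T (B (V 37) (V 18)))) (T (B (B (V 37) (V 18)) (F (V 26))))))))))
     (B (T (T (T (T (T (T (T (T (V 27))))))))) (T (B (T (T (T (T (T (T (V 27))))))) (T (T (T (T
     (T (T (V 20))))))))))) (F (B (T (T (T (T (T (T (T (T (V 35))))))))) (T (B (T (T (T (T (T (T
     (V 35))))))) (T (T (T (T (T (T (V 20)))))))))))"

definition "pot46 =
    F (B (B (B (T (T (T (T (T (T (B (B (V 40) (V 33)) (F (V 29))))))))) (T (B (T (T (T (T (B (B
     (V 40) (V 33)) (F (V 29))))))) (T (T (T (T (B (B (V 29) (V 26)) (F (V 26)))))))))) (B (T (T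
     (T (T (T (T (T (T (V 35))))))))) (T (B (T (T (T (T (T (T (V 35))))))) (T (T (T (T (T (T (V
     16))))))))))) (F (B (T (T (T (T (T (T (T (T (V 35))))))))) (T (B (T (T (T (T (T (T (V
     35))))))) (T (T (T (T (T (T (V 16))))))))))))"

definition "pot47 =
    B (B (B (B (T (T (T (T (B (B (B (B (V 33) (V 22)) (F (V 22))) (B (B (V 18) (V 23)) (B (V 27)
     (V 20)))) (B (B (B (V 22) (V 31)) (F (V 23))) (B (F (V 23)) (B (V 44) (V 21))))))))) (T (B
     (T (T (B (B (B (B (V 33) (V 22)) (F (V 22))) (B (B (V 18) (V 23)) (B (V 27) (V 20)))) (B (B
     (B (V 22) (V 31)) (F (V 23))) (B (F (V 23)) (B (V 44) (V 21))))))) (T (B (B (B (B (B (V 33)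
     (V 22)) (F (V 22))) (B (B (V 18) (V 23)) (B (V 27) (V 20)))) (B (B (B (V 22) (V 31)) (F (V
     23))) (B (F (V 23)) (B (V 44) (V 21))))) (B (B (B (B (V 38) (V 23)) (F (V 23))) (B (F (V
     15)) (T (V 29)))) (T (B (B (V 20) (V 33)) (B (V 25) (V 38)))))))))) (B (T (T (T (T (B (B (T
     (T (V 20))) (T (T (V 25)))) (B (T (T (V 25))) (T (T (V 34))))))))) (T (B (T (T (B (B (T (T
     (V 20))) (T (T (V 25)))) (B (T (T (V 25))) (T (T (V 34))))))) (T (B (B (B (T (T (V 20))) (T
     (T (V 25)))) (B (T (T (V 25))) (T (T (V 34))))) (B (B (T (T (V 25))) (T (T (V 38)))) (T (T
     (T (V 27))))))))))) (F (B (T (T (T (T (B (B (T (T (V 20))) (T (B (V 20) (V 33)))) (B (T (T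
     (V 21))) (T (F (V 21))))))))) (T (B (T (T (B (B (T (T (V 20))) (T (B (V 20) (V 33)))) (B (T
     (T (V 21))) (T (F (V 21))))))) (T (B (B (B (T (T (V 20))) (T (B (V 20) (V 33)))) (B (T (T (V
     21))) (T (F (V 21))))) (B (B (T (T (V 29))) (T (F (V 29)))) (T (T (T (V 27)))))))))))) (B (B
     (B (T (T (T (T (B (T (T (B (V 44) (V 21)))) (T (B (B (V 44) (V 21)) (B (V 33) (V 22)))))))))
     (T (B (T (T (B (T (T (B (V 44) (V 21)))) (T (B (B (V 44) (V 21)) (B (V 33) (V 22))))))) (T
     (B (B (T (T (B (V 44) (V 21)))) (T (B (B (V 44) (V 21)) (B (V 33) (V 22))))) (B (T (T (B (V
     37) (V 38)))) (T (B (B (V 37) (V 38)) (F (V 38)))))))))) (B (T (T (T (T (T (T (T (T (V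
     27))))))))) (T (B (T (T (T (T (T (T (V 27))))))) (T (B (T (T (T (T (V 27))))) (T (T (T (T (V
     20))))))))))) (F (B (T (T (T (T (T (T (T (T (V 27))))))))) (T (B (T (T (T (T (T (T (V
     27))))))) (T (B (T (T (T (T (V 27))))) (T (T (T (T (V 32))))))))))))"

definition "pot48 =
    B (B (B (B (T (T (T (T (T (T (B (B (V 20) (V 33)) (F (V 25))))))))) (T (B (T (T (T (T (B (B
     (V 20) (V 33)) (F (V 25))))))) (T (B (T (T (B (B (V 20) (V 33)) (F (V 25))))) (T (B (B (B (V
     20) (V 33)) (F (V 25))) (B (F (V 33)) (T (V 27)))))))))) (B (T (T (T (T (T (T (T (T (V
     27))))))))) (T (B (T (T (T (T (T (T (V 27))))))) (T (B (T (T (T (T (V 27))))) (T (B (T (T (V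
     27))) (T (T (V 40))))))))))) (F (B (T (T (T (T (T (T (T (T (V 27))))))))) (T (B (T (T (T (T
     (T (T (V 27))))))) (T (B (T (T (T (T (V 27))))) (T (B (T (T (V 27))) (T (F (V 27))))))))))))
     (F (F (T (T (T (T (T (T (T (T (B (V 35) (V 20))))))))))))"

definition "pot49 =
    F (B (B (B (T (T (T (T (T (T (B (B (B (V 16) (V 25)) (F (V 25))) (B (B (V 21) (V 22)) (B (V
     22) (V 35)))))))))) (T (T (T (T (T (T (B (T (T (V 27))) (T (T (V 12))))))))))) (F (T (T (T
     (T (T (T (B (T (T (V 35))) (T (B (V 35) (V 16)))))))))))) (F (F (T (T (T (T (T (T (T (T (B
     (V 27) (V 20)))))))))))))"

definition "pot50 =
    F (B (B (B (B (B (T (T (T (T (B (B (B (B (B (V 17) (V 18)) (F (V 30))) (B (B (V 10) (V 23))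
     (B (V 23) (V 20)))) (B (B (B (V 30) (V 27)) (F (V 23))) (B (F (V 23)) (B (V 44) (V 17)))))
     (B (B (B (B (V 22) (V 31)) (F (V 23))) (B (B (V 23) (V 28)) (B (V 28) (V 21)))) (B (B (B (V
     35) (V 24)) (F (V 24))) (B (B (V 20) (V 33)) (B (V 21) (V 14)))))))))) (T (T (T (T (B (B (B
     (T (T (V 20))) (T (T (V 33)))) (B (T (T (V 25))) (T (T (V 30))))) (B (B (T (T (V 29))) (T (T
     (V 34)))) (B (T (T (V 18))) (T (T (V 31))))))))))) (F (T (T (T (T (B (B (B (T (T (V 20))) (T
     (B (V 20) (V 17)))) (B (T (T (V 17))) (T (F (V 17))))) (B (B (T (T (V 21))) (T (B (V 21) (V
     30)))) (B (T (T (V 34))) (T (B (V 34) (V 27)))))))))))) (B (B (T (T (T (T (B (B (T (T (B (V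
     44) (V 21)))) (T (B (B (V 44) (V 21)) (B (V 37) (V 18))))) (B (T (T (B (V 21) (V 14)))) (T
     (B (B (V 21) (V 14)) (F (V 22)))))))))) (T (T (T (T (B (T (T (T (T (V 27))))) (T (T (T (T (V
     20))))))))))) (F (T (T (T (T (B (T (T (T (T (V 27))))) (T (T (T (T (V 4))))))))))))) (B (B
     (B (T (T (T (T (B (T (T (B (B (V 20) (V 33)) (F (V 33))))) (T (B (B (B (V 20) (V 33)) (F (V
     33))) (B (B (V 17) (V 18)) (B (V 34) (V 27)))))))))) (T (T (T (T (B (T (T (T (T (V 31)))))
     (T (B (T (T (V 31))) (T (T (V 28))))))))))) (F (T (T (T (T (B (T (T (T (T (V 27))))) (T (B
     (T (T (V 27))) (T (B (V 27) (V 32)))))))))))) (F (F (T (T (T (T (T (T (T (T (B (V 27) (V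
     20)))))))))))))) (F (B (B (B (T (T (T (T (T (T (B (B (B (V 20) (V 29)) (F (V 25))) (B (B (V
     17) (V 22)) (B (V 26) (V 35)))))))))) (T (T (T (T (T (T (B (T (T (V 35))) (T (T (V
     16))))))))))) (F (T (T (T (T (T (T (B (T (T (V 35))) (T (B (V 35) (V 20)))))))))))) (F (F (T
     (T (T (T (T (T (T (T (B (V 35) (V 20)))))))))))))))"

definition "pot51 =
    T (T (B (B (B (B (B (B (B (V 22) (V 15)) (F (V 15))) (B (B (V 23) (V 32)) (B (V 20) (V
     25)))) (B (B (B (V 39) (V 28)) (F (V 24))) (B (F (V 36)) (B (V 37) (V 18))))) (B (B (B (B (V
     19) (V 20)) (F (V 12))) (B (B (V 16) (V 21)) (B (V 25) (V 18)))) (B (B (B (V 32) (V 21)) (F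
     (V 21))) (B (B (V 25) (V 22)) (B (V 22) (V 19)))))) (B (B (B (B (B (V 23) (V 28)) (F (V
     20))) (B (B (V 20) (V 21)) (B (V 29) (V 26)))) (B (B (B (V 24) (V 21)) (F (V 13))) (B (F (V
     17)) (B (V 34) (V 19))))) (B (B (B (B (V 28) (V 5)) (F (V 21))) (B (F (V 21)) (T (V 23))))
     (B (B (B (V 29) (V 42)) (F (V 38))) (B (B (V 22) (V 31)) (B (V 19) (V 28))))))) (B (B (B (B
     (B (B (V 23) (V 32)) (F (V 32))) (B (B (V 20) (V 21)) (B (V 21) (V 26)))) (B (B (B (V 32) (V
     21)) (F (V 25))) (B (F (V 17)) (B (V 50) (V 23))))) (B (B (B (B (V 28) (V 21)) (F (V 25)))
     (B (B (V 17) (V 34)) (B (V 34) (V 23)))) (B (B (B (V 49) (V 34)) (F (V 26))) (B (B (V 14) (V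
     27)) (B (V 23) (V 28)))))) (B (B (B (B (B (V 20) (V 49)) (F (V 37))) (B (B (V 37) (V 26)) (B
     (V 26) (V 47)))) (B (B (B (V 49) (V 30)) (F (V 34))) (T (B (V 47) (V 36))))) (B (B (B (B (V
     33) (V 26)) (F (V 26))) (B (B (V 14) (V 23)) (B (V 27) (V 32)))) (B (B (B (V 22) (V 19)) (F
     (V 19))) (B (B (V 23) (V 24)) (B (V 16) (V 29)))))))))"

definition "pot52 =
    T (T (B (B (B (B (B (T (T (V 25))) (T (T (V 22)))) (B (T (T (V 22))) (T (T (V 43))))) (B (B
     (T (T (V 2))) (T (T (V 15)))) (B (T (T (V 15))) (T (T (V 20)))))) (B (B (B (T (T (V 22))) (T
     (T (V 19)))) (B (T (T (V 31))) (T (T (V 32))))) (B (B (T (T (V 15))) (T (T (V 32)))) (B (T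
     (T (V 36))) (T (T (V 25))))))) (B (B (B (B (T (T (V 22))) (T (T (V 23)))) (B (T (T (V 19)))
     (T (T (V 36))))) (B (B (T (T (V 15))) (T (T (V 36)))) (B (T (T (V 32))) (T (T (V 29)))))) (B
     (B (B (T (T (V 43))) (T (T (V 36)))) (F (T (T (V 32))))) (B (B (T (T (V 20))) (T (T (V
     29)))) (B (T (T (V 25))) (T (T (V 6)))))))))"

definition "pot53 =
    F (T (T (B (B (B (B (B (T (T (V 25))) (T (B (V 25) (V 26)))) (B (T (T (V 26))) (T (F (V
     26))))) (B (B (T (T (V 18))) (T (B (V 18) (V 23)))) (B (T (T (V 31))) (T (B (V 31) (V
     20)))))) (B (B (B (T (T (V 26))) (T (B (V 26) (V 23)))) (B (T (T (V 23))) (T (F (V 23)))))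
     (B (B (T (T (V 23))) (T (F (V 23)))) (B (T (T (V 44))) (T (B (V 44) (V 25))))))) (B (B (B (B
     (T (T (V 26))) (T (B (V 26) (V 23)))) (B (T (T (V 23))) (T (F (V 23))))) (B (B (T (T (V
     23))) (T (B (V 23) (V 28)))) (B (T (T (V 36))) (T (B (V 36) (V 25)))))) (B (B (B (T (T (V
     47))) (T (B (V 47) (V 20)))) (B (T (T (V 36))) (T (F (V 36))))) (B (B (T (T (V 32))) (T (B
     (V 32) (V 33)))) (B (T (T (V 29))) (T (B (V 29) (V 26))))))))))"

definition "pot54 =
    B (B (T (T (B (B (B (B (T (T (B (V 37) (V 18)))) (T (B (B (V 37) (V 18)) (B (V 22) (V
     35))))) (B (T (T (B (V 42) (V 19)))) (T (B (B (V 42) (V 19)) (F (V 31)))))) (B (B (T (T (B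
     (V 34) (V 19)))) (T (B (B (V 34) (V 19)) (B (V 31) (V 28))))) (B (T (T (B (V 35) (V 28))))
     (T (B (B (V 35) (V 28)) (B (V 28) (V 29))))))) (B (B (B (T (T (B (V 50) (V 27)))) (T (B (B
     (V 50) (V 27)) (B (V 31) (V 32))))) (B (T (T (B (V 39) (V 28)))) (T (B (B (V 39) (V 28)) (F
     (V 28)))))) (B (B (T (T (B (V 47) (V 36)))) (T (B (B (V 47) (V 36)) (F (V 20))))) (B (T (T
     (B (V 48) (V 37)))) (T (B (B (V 48) (V 37)) (B (V 33) (V 22)))))))))) (T (T (B (B (B (T (T
     (T (T (V 24))))) (T (T (T (T (V 25)))))) (B (T (T (T (T (V 17))))) (T (T (T (T (V 18)))))))
     (B (B (T (T (T (T (V 33))))) (T (T (T (T (V 22)))))) (B (T (T (T (T (V 34))))) (T (T (T (T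
     (V 31))))))))))) (F (T (T (B (B (B (T (T (T (T (V 20))))) (T (T (T (T (V 29)))))) (B (T (T
     (T (T (V 25))))) (T (T (T (T (V 18))))))) (B (B (T (T (T (T (V 33))))) (T (T (T (T (V
     34)))))) (B (T (T (T (T (V 30))))) (T (T (T (T (V 31)))))))))))"

definition "pot55 =
    B (B (B (T (T (B (B (B (T (T (B (B (V 25) (V 22)) (F (V 22))))) (T (B (B (B (V 25) (V 22))
     (F (V 22))) (B (B (V 26) (V 15)) (B (V 15) (V 20)))))) (B (T (T (B (B (V 22) (V 31)) (F (V
     19))))) (T (B (B (B (V 22) (V 31)) (F (V 19))) (B (F (V 23)) (T (V 25))))))) (B (B (T (T (B
     (B (V 14) (V 27)) (F (V 23))))) (T (B (B (B (V 14) (V 27)) (F (V 23))) (B (B (V 23) (V 32))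
     (B (V 36) (V 25)))))) (B (T (T (B (B (V 39) (V 32)) (F (V 36))))) (T (B (B (B (V 39) (V 32))
     (F (V 36))) (B (B (V 20) (V 33)) (B (V 29) (V 34)))))))))) (T (T (B (B (B (T (T (T (T (V
     20))))) (T (B (T (T (V 20))) (T (T (V 25)))))) (B (T (T (T (T (V 25))))) (T (B (T (T (V
     25))) (T (T (V 38))))))) (B (B (T (T (T (T (V 29))))) (T (B (T (T (V 29))) (T (T (V 38))))))
     (B (T (T (T (T (V 38))))) (T (B (T (T (V 38))) (T (T (V 19))))))))))) (F (T (T (B (B (B (T
     (T (T (T (V 20))))) (T (B (T (T (V 20))) (T (B (V 20) (V 25)))))) (B (T (T (T (T (V 25)))))
     (T (B (T (T (V 25))) (T (F (V 25))))))) (B (B (T (T (T (T (V 25))))) (T (B (T (T (V 25))) (T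
     (B (V 25) (V 38)))))) (B (T (T (T (T (V 34))))) (T (B (T (T (V 34))) (T (B (V 34) (V
     27)))))))))))) (F (F (T (T (B (B (T (T (T (T (B (V 44) (V 21)))))) (T (T (T (T (B (V 37) (V
     14))))))) (B (T (T (T (T (B (V 33) (V 18)))))) (T (T (T (T (B (V 54) (V 43))))))))))))"

definition "pot56 =
    B (B (B (B (T (T (B (B (T (T (B (B (B (V 29) (V 42)) (F (V 38))) (B (B (V 34) (V 39)) (B (V
     39) (V 44)))))) (T (B (B (B (B (V 29) (V 42)) (F (V 38))) (B (B (V 34) (V 39)) (B (V 39) (V
     44)))) (B (B (B (V 22) (V 35)) (F (V 31))) (B (B (V 31) (V 32)) (B (V 32) (V 29))))))) (B (T
     (T (B (B (B (V 22) (V 19)) (F (V 19))) (B (B (V 23) (V 24)) (B (V 16) (V 29)))))) (T (B (B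
     (B (B (V 22) (V 19)) (F (V 19))) (B (B (V 23) (V 24)) (B (V 16) (V 29)))) (B (B (B (V 39) (V
     32)) (F (V 32))) (T (B (V 33) (V 22)))))))))) (T (T (B (B (T (T (B (T (T (V 36))) (T (T (V
     29)))))) (T (B (B (T (T (V 36))) (T (T (V 29)))) (B (T (T (V 33))) (T (T (V 22))))))) (B (T
     (T (B (T (T (V 29))) (T (T (V 6)))))) (T (B (B (T (T (V 29))) (T (T (V 6)))) (F (T (T (V
     22))))))))))) (F (T (T (B (B (T (T (B (T (T (V 44))) (T (B (V 44) (V 29)))))) (T (B (B (T (T
     (V 44))) (T (B (V 44) (V 29)))) (B (T (T (V 29))) (T (B (V 29) (V 26))))))) (B (T (T (B (T
     (T (V 29))) (T (B (V 29) (V 26)))))) (T (B (B (T (T (V 29))) (T (B (V 29) (V 26)))) (B (T (T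
     (V 26))) (T (F (V 26)))))))))))) (B (B (T (T (B (B (T (T (T (T (B (V 52) (V 29)))))) (T (B
     (T (T (B (V 52) (V 29)))) (T (B (B (V 52) (V 29)) (B (V 29) (V 18))))))) (B (T (T (T (T (B
     (V 33) (V 22)))))) (T (B (T (T (B (V 33) (V 22)))) (T (B (B (V 33) (V 22)) (F (V
     22)))))))))) (T (T (B (T (T (T (T (T (T (V 35))))))) (T (T (T (T (T (T (V 20))))))))))) (F
     (T (T (B (T (T (T (T (T (T (V 35))))))) (T (T (T (T (T (T (V 16))))))))))))) (F (B (B (T (T
     (B (T (T (T (T (B (B (V 28) (V 33)) (F (V 29))))))) (T (T (T (T (B (B (V 29) (V 22)) (F (V
     6)))))))))) (T (T (B (T (T (T (T (T (T (V 19))))))) (T (T (T (T (T (T (V 12))))))))))) (F (T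
     (T (B (T (T (T (T (T (T (V 27))))))) (T (T (T (T (T (T (V 12)))))))))))))"

definition "pot57 =
    B (B (B (B (T (T (B (T (T (B (B (B (B (V 33) (V 26)) (F (V 26))) (B (B (V 14) (V 23)) (B (V
     27) (V 32)))) (B (B (B (V 26) (V 19)) (F (V 19))) (B (F (V 27)) (B (V 48) (V 29))))))) (T (B
     (B (B (B (B (V 33) (V 26)) (F (V 26))) (B (B (V 14) (V 23)) (B (V 27) (V 32)))) (B (B (B (V
     26) (V 19)) (F (V 19))) (B (F (V 27)) (B (V 48) (V 29))))) (B (B (B (B (V 30) (V 15)) (F (V
     15))) (B (B (V 23) (V 36)) (B (V 20) (V 25)))) (B (B (B (V 43) (V 36)) (F (V 28))) (B (B (V
     20) (V 33)) (B (V 29) (V 34)))))))))) (T (T (B (T (T (B (B (T (T (V 20))) (T (T (V 29)))) (B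
     (T (T (V 25))) (T (T (V 38))))))) (T (B (B (B (T (T (V 20))) (T (T (V 29)))) (B (T (T (V
     25))) (T (T (V 38))))) (B (B (T (T (V 25))) (T (T (V 38)))) (B (T (T (V 38))) (T (T (V
     19))))))))))) (F (T (T (B (T (T (B (B (T (T (V 32))) (T (B (V 32) (V 33)))) (B (T (T (V
     29))) (T (F (V 29))))))) (T (B (B (B (T (T (V 32))) (T (B (V 32) (V 33)))) (B (T (T (V 29)))
     (T (F (V 29))))) (B (B (T (T (V 25))) (T (B (V 25) (V 30)))) (B (T (T (V 34))) (T (B (V 34)
     (V 27)))))))))))) (B (B (T (T (B (T (T (B (T (T (B (V 48) (V 37)))) (T (B (B (V 48) (V 37))
     (B (V 33) (V 26))))))) (T (B (B (T (T (B (V 48) (V 37)))) (T (B (B (V 48) (V 37)) (B (V 33)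
     (V 26))))) (B (T (T (B (V 45) (V 34)))) (T (B (B (V 45) (V 34)) (B (V 38) (V 47)))))))))) (T
     (T (B (T (T (T (T (T (T (V 31))))))) (T (B (T (T (T (T (V 31))))) (T (T (T (T (V
     28))))))))))) (F (T (T (B (T (T (T (T (T (T (V 31))))))) (T (B (T (T (T (T (V 31))))) (T (T
     (T (T (V 28))))))))))))) (B (B (B (T (T (B (T (T (T (T (B (B (V 20) (V 33)) (F (V 29)))))))
     (T (B (T (T (B (B (V 20) (V 33)) (F (V 29))))) (T (B (B (B (V 20) (V 33)) (F (V 29))) (B (B
     (V 33) (V 38)) (B (V 38) (V 27)))))))))) (T (T (B (T (T (T (T (T (T (V 19))))))) (T (B (T (T
     (T (T (V 19))))) (T (B (T (T (V 19))) (T (T (V 40))))))))))) (F (T (T (B (T (T (T (T (T (T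
     (V 27))))))) (T (B (T (T (T (T (V 27))))) (T (B (T (T (V 27))) (T (B (V 27) (V
     40)))))))))))) (F (F (T (T (T (T (T (T (T (T (B (V 31) (V 24)))))))))))))"

definition "pot58 =
    F (B (B (B (T (T (T (T (T (T (B (B (B (V 16) (V 25)) (F (V 25))) (B (B (V 29) (V 22)) (B (V
     22) (V 35)))))))))) (T (T (T (T (T (T (B (T (T (V 19))) (T (T (V 12))))))))))) (F (T (T (T
     (T (T (T (B (T (T (V 35))) (T (B (V 35) (V 16)))))))))))) (F (F (T (T (T (T (T (T (T (T (B
     (V 35) (V 28)))))))))))))"

definition "pot59 =
    F (B (B (B (B (B (T (T (T (T (B (B (B (B (B (V 25) (V 18)) (F (V 22))) (B (B (V 10) (V 23))
     (B (V 23) (V 12)))) (B (B (B (V 22) (V 23)) (F (V 23))) (B (F (V 23)) (B (V 44) (V 25)))))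
     (B (B (B (B (V 22) (V 31)) (F (V 19))) (B (B (V 23) (V 24)) (B (V 24) (V 25)))) (B (B (B (V
     35) (V 24)) (F (V 24))) (B (B (V 20) (V 25)) (B (V 33) (V 14)))))))))) (T (T (T (T (B (B (B
     (T (T (V 24))) (T (T (V 33)))) (B (T (T (V 17))) (T (T (V 34))))) (B (B (T (T (V 25))) (T (T
     (V 22)))) (B (T (T (V 18))) (T (T (V 31))))))))))) (F (T (T (T (T (B (B (B (T (T (V 12))) (T
     (B (V 12) (V 25)))) (B (T (T (V 25))) (T (F (V 25))))) (B (B (T (T (V 25))) (T (B (V 25) (V
     22)))) (B (T (T (V 30))) (T (B (V 30) (V 27)))))))))))) (B (B (T (T (T (T (B (B (T (T (B (V
     44) (V 29)))) (T (B (B (V 44) (V 29)) (B (V 29) (V 18))))) (B (T (T (B (V 37) (V 14)))) (T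
     (B (B (V 37) (V 14)) (F (V 22)))))))))) (T (T (T (T (B (T (T (T (T (V 31))))) (T (T (T (T (V
     20))))))))))) (F (T (T (T (T (B (T (T (T (T (V 27))))) (T (T (T (T (V 20))))))))))))) (B (B
     (B (T (T (T (T (B (T (T (B (B (V 20) (V 25)) (F (V 33))))) (T (B (B (B (V 20) (V 25)) (F (V
     33))) (B (B (V 25) (V 18)) (B (V 22) (V 27)))))))))) (T (T (T (T (B (T (T (T (T (V 31)))))
     (T (B (T (T (V 31))) (T (T (V 28))))))))))) (F (T (T (T (T (B (T (T (T (T (V 27))))) (T (B
     (T (T (V 27))) (T (B (V 27) (V 20)))))))))))) (F (F (T (T (T (T (T (T (T (T (B (V 27) (V
     20)))))))))))))) (F (B (B (B (T (T (T (T (T (T (B (B (B (V 20) (V 29)) (F (V 25))) (B (B (V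
     25) (V 22)) (B (V 22) (V 27)))))))))) (T (T (T (T (T (T (B (T (T (V 35))) (T (T (V
     20))))))))))) (F (T (T (T (T (T (T (B (T (T (V 27))) (T (B (V 27) (V 20)))))))))))) (F (F (T
     (T (T (T (T (T (T (T (B (V 35) (V 12)))))))))))))))"

text \<open>Only the top levels of the trie are written out here. The named subtries keep terms
  small and let the certificate be checked part by part.\<close>

definition table :: trie where
  "table =
    B (B (B (B (B (B (B (B (B (B (B pot0 pot1) (B pot2 pot3)) pot4) (F (B pot5 pot6))) (B (B (B
     pot7 pot8) pot9) pot10)) (B (B (B (B pot11 pot12) pot13) pot14) pot15)) (B (B (B (B (B pot16
     pot17) pot18) pot19) pot20) pot21)) (B (B (B (B (B (B pot22 pot23) pot24) pot25) pot26)
     pot27) pot28)) (B (B (B (B (B (B (B pot29 pot30) pot31) pot32) pot33) pot34) (B pot35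
     pot36)) pot37)) (B (B (B (B (B (B (B (B pot38 pot39) pot40) pot41) pot42) pot43) (B (B pot44
     pot45) pot46)) (B (B pot47 pot48) pot49)) pot50)) (F (B (B (B (B (B (B (B pot51 pot52)
     pot53) pot54) pot55) pot56) (B pot57 pot58)) pot59))"

section \<open>Checking the certificate by rewriting\<close>

lemma fits_simps:
  "fits tshape1
    [a0, a1, a2, a3, a4, a5, a6, a7, a8, a9, a10, a11, a12, a13, a14, a15, a16, a17] \<longleftrightarrow>
     \<not> a0 \<and> \<not> a9 \<and> \<not> a10"
  "fits tshape2
    [a0, a1, a2, a3, a4, a5, a6, a7, a8, a9, a10, a11, a12, a13, a14, a15, a16, a17] \<longleftrightarrow>
     \<not> a0 \<and> \<not> a8 \<and> \<not> a9"
  "fits tshape3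
    [a0, a1, a2, a3, a4, a5, a6, a7, a8, a9, a10, a11, a12, a13, a14, a15, a16, a17] \<longleftrightarrow>
     \<not> a0 \<and> \<not> a1 \<and> \<not> a2 \<and> \<not> a10"
  "fits tshape4
    [a0, a1, a2, a3, a4, a5, a6, a7, a8, a9, a10, a11, a12, a13, a14, a15, a16, a17] \<longleftrightarrow>
     \<not> a0 \<and> \<not> a8 \<and> \<not> a9 \<and> \<not> a10"
  by (simp_all add: fits_def tshape_defs)

text \<open>For literal lists the next state is again a literal list of copied bits, so no list
  operation remains to be evaluated. A covered cell and a monomino have the same effect, because
  offset 0 leaves the window.\<close>

lemma advance_simps:
  "advance {}
    [a0, a1, a2, a3, a4, a5, a6, a7, a8, a9, a10, a11, a12, a13, a14, a15, a16, a17] =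
    [a1, a2, a3, a4, a5, a6, a7, a8, a9, a10, a11, a12, a13, a14, a15, a16, a17, False]"
  "advance {0}
    [a0, a1, a2, a3, a4, a5, a6, a7, a8, a9, a10, a11, a12, a13, a14, a15, a16, a17] =
    [a1, a2, a3, a4, a5, a6, a7, a8, a9, a10, a11, a12, a13, a14, a15, a16, a17, False]"
  "advance tshape1
    [a0, a1, a2, a3, a4, a5, a6, a7, a8, a9, a10, a11, a12, a13, a14, a15, a16, a17] =
    [a1, a2, a3, a4, a5, a6, a7, a8, True, True, a11, a12, a13, a14, a15, a16, a17, True]"
  "advance tshape2
    [a0, a1, a2, a3, a4, a5, a6, a7, a8, a9, a10, a11, a12, a13, a14, a15, a16, a17] =
    [a1, a2, a3, a4, a5, a6, a7, True, True, a10, a11, a12, a13, a14, a15, a16, a17, True]"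
  "advance tshape3
    [a0, a1, a2, a3, a4, a5, a6, a7, a8, a9, a10, a11, a12, a13, a14, a15, a16, a17] =
    [True, True, a3, a4, a5, a6, a7, a8, a9, True, a11, a12, a13, a14, a15, a16, a17, False]"
  "advance tshape4
    [a0, a1, a2, a3, a4, a5, a6, a7, a8, a9, a10, a11, a12, a13, a14, a15, a16, a17] =
    [a1, a2, a3, a4, a5, a6, a7, True, True, True, a11, a12, a13, a14, a15, a16, a17, False]"
  by (simp_all add: advance_def tshape_defs upt_conv_Cons)

text \<open>There is one rule for each of the four distinct entries of \<open>rows\<close>. The test
  for a fitting tile is a nested \<open>if\<close>, so that with weak congruence a blocked placement
  disappears before its recursive call is touched.\<close>

lemma column_ok_simps:
  "column_ok t [] c
    [a0, a1, a2, a3, a4, a5, a6, a7, a8, a9, a10, a11, a12, a13, a14, a15, a16, a17] =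
   (case lookup t
     [a17, a16, a15, a14, a13, a12, a11, a10, a9, a8, a7, a6, a5, a4, a3, a2, a1, a0]
    of None \<Rightarrow> False | Some v \<Rightarrow> v < c)"
  "column_ok t (Ds # rs) c
    [True, a1, a2, a3, a4, a5, a6, a7, a8, a9, a10, a11, a12, a13, a14, a15, a16, a17] =
   column_ok t rs c
    [a1, a2, a3, a4, a5, a6, a7, a8, a9, a10, a11, a12, a13, a14, a15, a16, a17, False]"
  "column_ok t ([tshape1, tshape3] # rs) c
    [False, a1, a2, a3, a4, a5, a6, a7, a8, a9, a10, a11, a12, a13, a14, a15, a16, a17] \<longleftrightarrow>
       (if a9 then True else if a10 then True else column_ok t rs c
         [a1, a2, a3, a4, a5, a6, a7, a8, True, True, a11, a12, a13, a14, a15, a16, a17,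
           True]) \<and>
       (if a1 then True else if a2 then True else if a10 then True else column_ok t rs c
         [True, True, a3, a4, a5, a6, a7, a8, a9, True, a11, a12, a13, a14, a15, a16, a17,
           False]) \<and>
       column_ok t rs (c + 17)
         [a1, a2, a3, a4, a5, a6, a7, a8, a9, a10, a11, a12, a13, a14, a15, a16, a17,
           False]"
  "column_ok t ([tshape1, tshape2, tshape3, tshape4] # rs) c
    [False, a1, a2, a3, a4, a5, a6, a7, a8, a9, a10, a11, a12, a13, a14, a15, a16, a17] \<longleftrightarrow>
       (if a9 then True else if a10 then True else column_ok t rs c
         [a1, a2, a3, a4, a5, a6, a7, a8, True, True, a11, a12, a13, a14, a15, a16, a17,
           True]) \<and>
       (if a8 then True else if a9 then True else column_ok t rs c
         [a1, a2, a3, a4, a5, a6, a7, True, True, a10, a11, a12, a13, a14, a15, a16, a17,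
           True]) \<and>
       (if a1 then True else if a2 then True else if a10 then True else column_ok t rs c
         [True, True, a3, a4, a5, a6, a7, a8, a9, True, a11, a12, a13, a14, a15, a16, a17,
           False]) \<and>
       (if a8 then True else if a9 then True else if a10 then True else column_ok t rs c
         [a1, a2, a3, a4, a5, a6, a7, True, True, True, a11, a12, a13, a14, a15, a16, a17,
           False]) \<and>
       column_ok t rs (c + 17)
         [a1, a2, a3, a4, a5, a6, a7, a8, a9, a10, a11, a12, a13, a14, a15, a16, a17,
           False]"
  "column_ok t ([tshape1, tshape2, tshape4] # rs) c
    [False, a1, a2, a3, a4, a5, a6, a7, a8, a9, a10, a11, a12, a13, a14, a15, a16, a17] \<longleftrightarrow>
       (if a9 then True else if a10 then True else column_ok t rs c
         [a1, a2, a3, a4, a5, a6, a7, a8, True, True, a11, a12, a13, a14, a15, a16, a17,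
           True]) \<and>
       (if a8 then True else if a9 then True else column_ok t rs c
         [a1, a2, a3, a4, a5, a6, a7, True, True, a10, a11, a12, a13, a14, a15, a16, a17,
           True]) \<and>
       (if a8 then True else if a9 then True else if a10 then True else column_ok t rs c
         [a1, a2, a3, a4, a5, a6, a7, True, True, True, a11, a12, a13, a14, a15, a16, a17,
           False]) \<and>
       column_ok t rs (c + 17)
         [a1, a2, a3, a4, a5, a6, a7, a8, a9, a10, a11, a12, a13, a14, a15, a16, a17,
           False]"
  "column_ok t ([tshape2] # rs) c
    [False, a1, a2, a3, a4, a5, a6, a7, a8, a9, a10, a11, a12, a13, a14, a15, a16, a17] \<longleftrightarrow>
       (if a8 then True else if a9 then True else column_ok t rs c
         [a1, a2, a3, a4, a5, a6, a7, True, True, a10, a11, a12, a13, a14, a15, a16, a17,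
           True]) \<and>
       column_ok t rs (c + 17)
         [a1, a2, a3, a4, a5, a6, a7, a8, a9, a10, a11, a12, a13, a14, a15, a16, a17,
           False]"
  by (simp_all add: fits_simps advance_simps)

text \<open>All arguments below are in normal form except where a congruence rule lets the simplifier
  descend; in particular each part of the table is unfolded only when it is reached.\<close>

lemma eval_congs:
  "F x = F x" "T x = T x" "B x y = B x y"
  "x = x' \<Longrightarrow> lookup x s = lookup x' s"
  "c = c' \<Longrightarrow> column_ok t rs c s = column_ok t rs c' s"
  "x = x' \<Longrightarrow> all_columns_ok t x s = all_columns_ok t x' s"
  by simp_all

text \<open>Opens \<open>table\<close> only directly under \<open>lookup\<close>. Rewriting with
  \<open>table_def\<close> itself could also expand the table where it must remain a name for
  further lookups.\<close>

lemma lookup_table: "lookup table s = lookup (B (B (B (B (B (B (B (B (B (B (B pot0 pot1) (B pot2 pot3)) pot4) (F (B pot5 pot6))) (B (B (B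
     pot7 pot8) pot9) pot10)) (B (B (B (B pot11 pot12) pot13) pot14) pot15)) (B (B (B (B (B pot16
     pot17) pot18) pot19) pot20) pot21)) (B (B (B (B (B (B pot22 pot23) pot24) pot25) pot26)
     pot27) pot28)) (B (B (B (B (B (B (B pot29 pot30) pot31) pot32) pot33) pot34) (B pot35
     pot36)) pot37)) (B (B (B (B (B (B (B (B pot38 pot39) pot40) pot41) pot42) pot43) (B (B pot44
     pot45) pot46)) (B (B pot47 pot48) pot49)) pot50)) (F (B (B (B (B (B (B (B pot51 pot52)
     pot53) pot54) pot55) pot56) (B pot57 pot58)) pot59))) s"
  by (simp only: table_def)

text \<open>Unfolding \<open>rows_def\<close> inside the leaf rule makes the rows literal, while the
  names of the shapes stay folded, as the left-hand sides in \<open>column_ok_simps\<close> require.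
  The comparisons of values at the ends of columns are decided by \<open>rel_simps\<close> and
  \<open>arith_simps\<close>.\<close>

lemmas eval_simps = all_columns_ok.simps[unfolded rows_def] column_ok_simps lookup_table lookup.simps
  if_True if_False simp_thms option.case rel_simps arith_simps
  pot0_def pot1_def pot2_def pot3_def pot4_def pot5_def pot6_def pot7_def pot8_def pot9_def
  pot10_def pot11_def pot12_def pot13_def pot14_def pot15_def pot16_def pot17_def pot18_def
  pot19_def pot20_def pot21_def pot22_def pot23_def pot24_def pot25_def pot26_def pot27_def
  pot28_def pot29_def pot30_def pot31_def pot32_def pot33_def pot34_def pot35_def pot36_def
  pot37_def pot38_def pot39_def pot40_def pot41_def pot42_def pot43_def pot44_def pot45_def
  pot46_def pot47_def pot48_def pot49_def pot50_def pot51_def pot52_def pot53_def pot54_def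
  pot55_def pot56_def pot57_def pot58_def pot59_def

text \<open>In this and the following five lemmas, each bit list is the path from the root of
  \<open>table\<close> to the part, last step first; equivalently, it is the common end of all
  states stored in that part.\<close>

lemma all_columns_ok_pots1:
  "all_columns_ok table pot0 [False, False, False, False, False, False, False, False, False, False, False]"
  by (simp_all only: eval_simps cong: eval_congs if_weak_cong option.case_cong_weak)

lemma all_columns_ok_pots2:
  "all_columns_ok table pot1 [True, False, False, False, False, False, False, False, False, False, False]"
  "all_columns_ok table pot2 [False, True, False, False, False, False, False, False, False, False, False]"
  by (simp_all only: eval_simps cong: eval_congs if_weak_cong option.case_cong_weak)

lemma all_columns_ok_pots3:
  "all_columns_ok table pot3 [True, True, False, False, False, False, False, False, False, False, False]"
  "all_columns_ok table pot4 [True, False, False, False, False, False, False, False, False]"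
  "all_columns_ok table pot5 [False, False, True, False, False, False, False, False, False, False]"
  by (simp_all only: eval_simps cong: eval_congs if_weak_cong option.case_cong_weak)

lemma all_columns_ok_pots4:
  "all_columns_ok table pot6 [True, False, True, False, False, False, False, False, False, False]"
  "all_columns_ok table pot7 [False, False, False, True, False, False, False, False, False, False]"
  "all_columns_ok table pot8 [True, False, False, True, False, False, False, False, False, False]"
  "all_columns_ok table pot9 [True, False, True, False, False, False, False, False, False]"
  "all_columns_ok table pot10 [True, True, False, False, False, False, False, False]"
  "all_columns_ok table pot11 [False, False, False, False, True, False, False, False, False, False]"
  "all_columns_ok table pot12 [True, False, False, False, True, False, False, False, False, False]"
  "all_columns_ok table pot13 [True, False, False, True, False, False, False, False, False]"
  "all_columns_ok table pot14 [True, False, True, False, False, False, False, False]"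
  "all_columns_ok table pot15 [True, True, False, False, False, False, False]"
  "all_columns_ok table pot16 [False, False, False, False, False, True, False, False, False, False]"
  "all_columns_ok table pot17 [True, False, False, False, False, True, False, False, False, False]"
  "all_columns_ok table pot18 [True, False, False, False, True, False, False, False, False]"
  "all_columns_ok table pot19 [True, False, False, True, False, False, False, False]"
  by (simp_all only: eval_simps cong: eval_congs if_weak_cong option.case_cong_weak)

lemma all_columns_ok_pots5:
  "all_columns_ok table pot20 [True, False, True, False, False, False, False]"
  "all_columns_ok table pot21 [True, True, False, False, False, False]"
  "all_columns_ok table pot22 [False, False, False, False, False, False, True, False, False, False]"
  "all_columns_ok table pot23 [True, False, False, False, False, False, True, False, False, False]"
  "all_columns_ok table pot24 [True, False, False, False, False, True, False, False, False]"
  "all_columns_ok table pot25 [True, False, False, False, True, False, False, False]"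
  "all_columns_ok table pot26 [True, False, False, True, False, False, False]"
  "all_columns_ok table pot27 [True, False, True, False, False, False]"
  "all_columns_ok table pot28 [True, True, False, False, False]"
  "all_columns_ok table pot29 [False, False, False, False, False, False, False, True, False, False]"
  "all_columns_ok table pot30 [True, False, False, False, False, False, False, True, False, False]"
  "all_columns_ok table pot31 [True, False, False, False, False, False, True, False, False]"
  "all_columns_ok table pot32 [True, False, False, False, False, True, False, False]"
  "all_columns_ok table pot33 [True, False, False, False, True, False, False]"
  "all_columns_ok table pot34 [True, False, False, True, False, False]"
  "all_columns_ok table pot35 [False, True, False, True, False, False]"
  "all_columns_ok table pot36 [True, True, False, True, False, False]"
  "all_columns_ok table pot37 [True, True, False, False]"
  "all_columns_ok table pot38 [False, False, False, False, False, False, False, False, True, False]"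
  "all_columns_ok table pot39 [True, False, False, False, False, False, False, False, True, False]"
  by (simp_all only: eval_simps cong: eval_congs if_weak_cong option.case_cong_weak)

lemma all_columns_ok_pots6:
  "all_columns_ok table pot40 [True, False, False, False, False, False, False, True, False]"
  "all_columns_ok table pot41 [True, False, False, False, False, False, True, False]"
  "all_columns_ok table pot42 [True, False, False, False, False, True, False]"
  "all_columns_ok table pot43 [True, False, False, False, True, False]"
  "all_columns_ok table pot44 [False, False, True, False, False, True, False]"
  "all_columns_ok table pot45 [True, False, True, False, False, True, False]"
  "all_columns_ok table pot46 [True, True, False, False, True, False]"
  "all_columns_ok table pot47 [False, False, True, False, True, False]"
  "all_columns_ok table pot48 [True, False, True, False, True, False]"
  "all_columns_ok table pot49 [True, True, False, True, False]"
  "all_columns_ok table pot50 [True, True, False]"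
  "all_columns_ok table pot51 [False, False, False, False, False, False, False, False, True]"
  "all_columns_ok table pot52 [True, False, False, False, False, False, False, False, True]"
  "all_columns_ok table pot53 [True, False, False, False, False, False, False, True]"
  "all_columns_ok table pot54 [True, False, False, False, False, False, True]"
  "all_columns_ok table pot55 [True, False, False, False, False, True]"
  "all_columns_ok table pot56 [True, False, False, False, True]"
  "all_columns_ok table pot57 [False, True, False, False, True]"
  "all_columns_ok table pot58 [True, True, False, False, True]"
  "all_columns_ok table pot59 [True, False, True]"
  by (simp_all only: eval_simps cong: eval_congs if_weak_cong option.case_cong_weak)

lemma all_columns_ok_table: "all_columns_ok table table []"
  \<comment> \<open>Only the second occurrence, the trie being traversed, is opened. The first one
    serves the lookups and must stay folded to match the facts about the parts.\<close>
  by (subst (2) table_def)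
    (simp only: all_columns_ok.simps simp_thms all_columns_ok_pots1 all_columns_ok_pots2 all_columns_ok_pots3
      all_columns_ok_pots4 all_columns_ok_pots5 all_columns_ok_pots6 cong: eval_congs)

lemma lookup_table_empty: "lookup table (replicate 18 False) = Some 7"
proof -
  have bits: "replicate 18 False =
      [False, False, False, False, False, False, False, False, False, False, False, False,
       False, False, False, False, False, False]"
    by (simp add: numeral_eq_Suc)
  show ?thesis unfolding bits by (simp only: eval_simps cong: eval_congs if_weak_cong)
qed


theorem theorem2:
  "\<exists>e\<^sub>9 :: nat \<Rightarrow> int.
     (\<exists>B. \<forall>n\<ge>1. \<bar>e\<^sub>9 n\<bar> \<le> B) \<and>
     (\<forall>n\<ge>1. int (gap_number 9 n) = \<lfloor>real n / 17\<rfloor> + e\<^sub>9 n)"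
proof (intro exI conjI allI impI)
  fix n :: nat
  have "\<lfloor>real n / 17\<rfloor> = int (n div 17)"
    using floor_divide_of_nat_eq[of n 17] by simp
  \<comment> \<open>This goal instantiates the error term, left schematic by \<open>exI\<close>,
    with the difference of the gap number and \<open>n div 17\<close>.\<close>
  then show "int (gap_number 9 n) = \<lfloor>real n / 17\<rfloor> + (int (gap_number 9 n) - int (n div 17))"
    by simp
  have "n \<le> 7 + 17 * gap_number 9 n"
    using all_columns_ok_table lookup_table_empty by (rule gap_number_9_ge)
  \<comment> \<open>The constant 7 is the value of the empty state. Being less than 17, it is
    absorbed by the rounding, so the error term is at least -1; its upper bound 162 then bounds the
    absolute value.\<close>
  then have "n div 17 \<le> gap_number 9 n + 1" by linarith
  with gap_number_9_le[of n] show "\<bar>int (gap_number 9 n) - int (n div 17)\<bar> \<le> 162"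
    by linarith
qed

end
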